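(* For any unweighted Eulerian graph $G$ with minimum degree $\delta_G>0$, given the decay factor $\alpha\in(0,1)$, a target node $t\in V$, and $\delta_G$, there exists a randomized algorithm that estimates the PageRank value $\pi_{G,\alpha}(t)$ within relative error $\varepsilon$ with probability at least $3/4$ in time $$O\!\left(\frac{1}{\alpha\varepsilon^2}\cdot\frac{d_G(t)}{\delta_G}\cdot\frac{1}{n\pi_{G,\alpha}(t)}\right)=O\!\left(\frac{1}{\varepsilon^2\delta_G}\min\Big(\frac{d_G(t)}{\alpha^2},\frac{m/d_G(t)}{\alpha^2},\frac{\Delta_G}{\alpha},\frac{\sqrt m}{\alpha}\Big)\right).$$
   Context: $G=(V,E)$ is a directed graph with $V=[n]$, $m=|E|$, adjacency matrix $A_G$, out-degrees $d^+_G(v)$ and in-degrees $d^-_G(v)$; $D_G$ is the diagonal out-degree matrix. $G$ is Eulerian if $d^-_G(v)=d^+_G(v)=:d_G(v)$ for all $v$; $\delta_G,\Delta_G$ are the minimum and maximum degree. The PageRank vector $\pi_{G,\alpha}$ is the unique solution of $(I-(1-\alpha)A_G^{\top}D_G^{-1})\pi=\frac{\alpha}{n}\mathbf 1$. The graph is accessed in the adjacency-list model: degree queries and neighbor queries (returning a neighbor) take $O(1)$ time.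
   Formalization: The relative error is taken with 0 < ε ≤ 1, and the equality of the two O-bounds is proved with a constant that is uniform only for α ≤ α₀ with α₀ < 1 fixed; a constant uniform as α → 1 fails, e.g. for the centre of a bidirected star with α = 1 − 1/N. *)

theory Defs
  imports
    "HOL-Probability.Probability"
    "Jordan_Normal_Form.Matrix"
    "Graph_Theory.Pair_Digraph"
begin

section \<open>Directed graphs and PageRank\<close>

text \<open>
  Unweighted digraphs are digraphs without parallel arcs; self-loops are allowed.
  The vertex set \<open>[n]\<close> is rendered as \<open>{..<n}\<close>, to agree with the indexing of matrices.
\<close>

abbreviation order_of :: "nat pair_pre_digraph \<Rightarrow> nat" where
  "order_of G \<equiv> card (pverts G)"

definition labelled_digraph :: "nat pair_pre_digraph \<Rightarrow> bool" where
  "labelled_digraph G \<longleftrightarrow> pair_fin_digraph G \<and> pverts G = {..<order_of G}"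

definition eulerian :: "nat pair_pre_digraph \<Rightarrow> bool" where
  "eulerian G \<longleftrightarrow> (\<forall>v \<in> pverts G. in_degree G v = out_degree G v)"

definition min_degree :: "nat pair_pre_digraph \<Rightarrow> nat" where
  "min_degree G = Min (out_degree G ` pverts G)"

definition max_degree :: "nat pair_pre_digraph \<Rightarrow> nat" where
  "max_degree G = Max (out_degree G ` pverts G)"

definition adjacency_mat :: "nat pair_pre_digraph \<Rightarrow> real mat" where
  "adjacency_mat G =
    Matrix.mat (order_of G) (order_of G) (\<lambda>(u, v). if (u, v) \<in> parcs G then 1 else 0)"

definition outdeg_mat :: "nat pair_pre_digraph \<Rightarrow> real mat" where
  "outdeg_mat G = mat_diag (order_of G) (\<lambda>v. real (out_degree G v))"

definition outdeg_mat_inv :: "nat pair_pre_digraph \<Rightarrow> real mat" where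
  "outdeg_mat_inv G = mat_diag (order_of G) (\<lambda>v. 1 / real (out_degree G v))"

lemma outdeg_mat_inv:
  assumes "labelled_digraph G" and "\<forall>v \<in> pverts G. out_degree G v > 0"
  shows "outdeg_mat G * outdeg_mat_inv G = 1\<^sub>m (order_of G)"
    and "outdeg_mat_inv G * outdeg_mat G = 1\<^sub>m (order_of G)"
proof -
  have pos: "out_degree G v \<noteq> 0" if "v < order_of G" for v
    using assms that by (force simp: labelled_digraph_def)
  show "outdeg_mat G * outdeg_mat_inv G = 1\<^sub>m (order_of G)"
    "outdeg_mat_inv G * outdeg_mat G = 1\<^sub>m (order_of G)"
    by (auto intro!: eq_matI simp: outdeg_mat_def outdeg_mat_inv_def mat_diag_diag pos)
      (auto simp: mat_diag_def pos)
qed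

definition is_pagerank :: "nat pair_pre_digraph \<Rightarrow> real \<Rightarrow> real vec \<Rightarrow> bool" where
  "is_pagerank G \<alpha> p \<longleftrightarrow>
    p \<in> carrier_vec (order_of G) \<and>
    (1\<^sub>m (order_of G) - (1 - \<alpha>) \<cdot>\<^sub>m (transpose_mat (adjacency_mat G) * outdeg_mat_inv G)) *\<^sub>v p
      = (\<alpha> / real (order_of G)) \<cdot>\<^sub>v Matrix.vec (order_of G) (\<lambda>_. 1)"

definition pagerank :: "nat pair_pre_digraph \<Rightarrow> real \<Rightarrow> real vec" where
  "pagerank G \<alpha> = (THE p. is_pagerank G \<alpha> p)"


section \<open>Randomized algorithms in the adjacency-list model\<close>

text \<open>
  The graph is accessed through adjacency lists of out- and in-neighbours, whose order is
  arbitrary (i.e. chosen by an adversary).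
\<close>

record adj_lists =
  out_list :: "nat \<Rightarrow> nat list"
  in_list :: "nat \<Rightarrow> nat list"

definition represents :: "adj_lists \<Rightarrow> nat pair_pre_digraph \<Rightarrow> bool" where
  "represents L G \<longleftrightarrow>
    (\<forall>v. distinct (out_list L v) \<and> set (out_list L v) = {w. (v, w) \<in> parcs G} \<and>
         distinct (in_list L v) \<and> set (in_list L v) = {u. (u, v) \<in> parcs G})"

text \<open>
  Algorithms are programs of a probabilistic unit-cost random access machine with two
  memories, one for natural numbers and one for real numbers.  Every instruction, whether
  arithmetic, query, random choice or jump, takes one time step.  To avoid the well-known
  excessive power of unit-cost machines, naturals can only be added and subtracted, reals can
  only undergo field operations and comparison (no rounding), and all constants are naturals.
  Operands are memory addresses, except for the constant in \<open>NConst\<close> and the jump targets.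
\<close>

datatype instr =
    NConst nat nat
  | NMove nat nat
  | NAdd nat nat nat
  | NSub nat nat nat
  | NLoad nat nat
  | NStore nat nat
  | RMove nat nat
  | ROfNat nat nat
  | RAdd nat nat nat
  | RSub nat nat nat
  | RMul nat nat nat
  | RDiv nat nat nat
  | RLoad nat nat
  | RStore nat nat
  | OutDeg nat nat
  | InDeg nat nat
  | OutNbr nat nat nat
  | InNbr nat nat nat
  | Uniform nat nat
  | Coin nat nat
  | Jump nat
  | JumpNLe nat nat nat
  | JumpRLe nat nat nat

record config =
  pc :: nat
  nmem :: "nat \<Rightarrow> nat"
  rmem :: "nat \<Rightarrow> real"

definition set_nat :: "nat \<Rightarrow> nat \<Rightarrow> config \<Rightarrow> config" where
  "set_nat a x c = c\<lparr>pc := Suc (pc c), nmem := (nmem c)(a := x)\<rparr>"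

definition set_real :: "nat \<Rightarrow> real \<Rightarrow> config \<Rightarrow> config" where
  "set_real a x c = c\<lparr>pc := Suc (pc c), rmem := (rmem c)(a := x)\<rparr>"

definition branch :: "bool \<Rightarrow> nat \<Rightarrow> config \<Rightarrow> config" where
  "branch b l c = c\<lparr>pc := (if b then l else Suc (pc c))\<rparr>"

definition nbr_query :: "nat list \<Rightarrow> nat \<Rightarrow> nat" where
  "nbr_query xs i = (if i < length xs then xs ! i else 0)"

text \<open>
  \<open>Uniform a k\<close> draws a uniform number below the content of cell \<open>k\<close>; \<open>Coin a p\<close> draws a bit
  that is \<open>1\<close> with the probability stored in the real cell \<open>p\<close> (clipped to the unit interval
  by \<open>bernoulli_pmf\<close>).
\<close>

fun exec :: "adj_lists \<Rightarrow> instr \<Rightarrow> config \<Rightarrow> config pmf" where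
  "exec L (NConst a k) c = return_pmf (set_nat a k c)"
| "exec L (NMove a x) c = return_pmf (set_nat a (nmem c x) c)"
| "exec L (NAdd a x y) c = return_pmf (set_nat a (nmem c x + nmem c y) c)"
| "exec L (NSub a x y) c = return_pmf (set_nat a (nmem c x - nmem c y) c)"
| "exec L (NLoad a x) c = return_pmf (set_nat a (nmem c (nmem c x)) c)"
| "exec L (NStore x y) c = return_pmf (set_nat (nmem c x) (nmem c y) c)"
| "exec L (RMove a x) c = return_pmf (set_real a (rmem c x) c)"
| "exec L (ROfNat a x) c = return_pmf (set_real a (real (nmem c x)) c)"
| "exec L (RAdd a x y) c = return_pmf (set_real a (rmem c x + rmem c y) c)"
| "exec L (RSub a x y) c = return_pmf (set_real a (rmem c x - rmem c y) c)"
| "exec L (RMul a x y) c = return_pmf (set_real a (rmem c x * rmem c y) c)"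
| "exec L (RDiv a x y) c = return_pmf (set_real a (rmem c x / rmem c y) c)"
| "exec L (RLoad a x) c = return_pmf (set_real a (rmem c (nmem c x)) c)"
| "exec L (RStore x y) c = return_pmf (set_real (nmem c x) (rmem c y) c)"
| "exec L (OutDeg a v) c = return_pmf (set_nat a (length (out_list L (nmem c v))) c)"
| "exec L (InDeg a v) c = return_pmf (set_nat a (length (in_list L (nmem c v))) c)"
| "exec L (OutNbr a v i) c =
     return_pmf (set_nat a (nbr_query (out_list L (nmem c v)) (nmem c i)) c)"
| "exec L (InNbr a v i) c =
     return_pmf (set_nat a (nbr_query (in_list L (nmem c v)) (nmem c i)) c)"
| "exec L (Uniform a k) c =
     (if nmem c k = 0 then return_pmf (set_nat a 0 c)
      else map_pmf (\<lambda>x. set_nat a x c) (pmf_of_set {..<nmem c k}))"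
| "exec L (Coin a p) c = map_pmf (\<lambda>b. set_nat a (of_bool b) c) (bernoulli_pmf (rmem c p))"
| "exec L (Jump l) c = return_pmf (branch True l c)"
| "exec L (JumpNLe x y l) c = return_pmf (branch (nmem c x \<le> nmem c y) l c)"
| "exec L (JumpRLe x y l) c = return_pmf (branch (rmem c x \<le> rmem c y) l c)"

definition halted :: "instr list \<Rightarrow> config \<Rightarrow> bool" where
  "halted P c \<longleftrightarrow> length P \<le> pc c"

definition step :: "adj_lists \<Rightarrow> instr list \<Rightarrow> config \<Rightarrow> config pmf" where
  "step L P c = (if halted P c then return_pmf c else exec L (P ! pc c) c)"

primrec run :: "adj_lists \<Rightarrow> instr list \<Rightarrow> nat \<Rightarrow> config \<Rightarrow> config pmf" where
  "run L P 0 c = return_pmf c"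
| "run L P (Suc k) c = bind_pmf (step L P c) (run L P k)"

text \<open>The algorithm receives \<open>n\<close>, \<open>t\<close>, \<open>\<delta>\<close>, \<open>\<alpha>\<close> and \<open>\<epsilon>\<close>; all other cells are \<open>0\<close>.\<close>

definition init_config :: "nat \<Rightarrow> nat \<Rightarrow> nat \<Rightarrow> real \<Rightarrow> real \<Rightarrow> config" where
  "init_config n t \<delta> \<alpha> \<epsilon> =
    \<lparr>pc = 0, nmem = (\<lambda>_. 0)(0 := n, 1 := t, 2 := \<delta>), rmem = (\<lambda>_. 0)(0 := \<alpha>, 1 := \<epsilon>)\<rparr>"

definition result :: "config \<Rightarrow> real" where
  "result c = rmem c 0"

text \<open>
  Since halting configurations are absorbing, the running time \<open>T\<close> exceeds \<open>k\<close> iff the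
  configuration after \<open>k\<close> steps is not halted, so this is \<open>E T = (\<Sum>k. P (T > k))\<close>.
\<close>

definition expected_time :: "adj_lists \<Rightarrow> instr list \<Rightarrow> config \<Rightarrow> ennreal" where
  "expected_time L P c =
    (\<Sum>k. ennreal (measure_pmf.prob (run L P k c) {c'. \<not> halted P c'}))"

definition succeeds_within ::
  "adj_lists \<Rightarrow> instr list \<Rightarrow> config \<Rightarrow> real \<Rightarrow> real \<Rightarrow> real \<Rightarrow> real \<Rightarrow> bool" where
  "succeeds_within L P c x \<epsilon> T q \<longleftrightarrow>
    measure_pmf.prob (run L P (nat \<lfloor>T\<rfloor>) c) {c'. halted P c' \<and> \<bar>result c' - x\<bar> \<le> \<epsilon> * x} \<ge> q"


section \<open>The complexity bounds\<close>

definition pagerank_time_bound :: "nat pair_pre_digraph \<Rightarrow> real \<Rightarrow> nat \<Rightarrow> real \<Rightarrow> real" where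
  "pagerank_time_bound G \<alpha> t \<epsilon> =
    1 / (\<alpha> * \<epsilon>\<^sup>2) * (real (out_degree G t) / real (min_degree G))
      * (1 / (real (order_of G) * vec_index (pagerank G \<alpha>) t))"

definition degree_time_bound :: "nat pair_pre_digraph \<Rightarrow> real \<Rightarrow> nat \<Rightarrow> real \<Rightarrow> real" where
  "degree_time_bound G \<alpha> t \<epsilon> =
    (let d = real (out_degree G t); m = real (card (parcs G)); \<Delta> = real (max_degree G) in
      1 / (\<epsilon>\<^sup>2 * real (min_degree G))
        * Min {d / \<alpha>\<^sup>2, (m / d) / \<alpha>\<^sup>2, \<Delta> / \<alpha>, sqrt m / \<alpha>})"

end

theory Submission
  imports Defs "Jordan_Normal_Form.Determinant"
begin

text \<open>
  On an Eulerian graph with \<open>n\<close> vertices, \<open>y v = n \<pi>(v) / d(v)\<close> satisfies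
  \<open>y v = \<alpha> / d(v) + (1 - \<alpha>) avg y\<close>, the average being over the in-neighbours of \<open>v\<close>.  So
  \<open>\<delta> y(t)\<close> is the probability \<open>p\<close> that a backward random walk from \<open>t\<close>, stopped with probability
  \<open>\<alpha>\<close> in each step, followed by a coin of bias \<open>\<delta> / d\<close> at its end, succeeds.  The algorithm
  repeats such rounds until it has seen \<open>\<Theta> = 24 / \<epsilon>\<^sup>2\<close> successes and estimates \<open>p\<close> by the ratio of
  the number \<open>s\<close> of successes to the number \<open>N\<close> of rounds.  The expected time is
  \<open>O(\<Theta> / (\<alpha> p))\<close>, and the martingale \<open>(p N - s)\<^sup>2 + (1 - p) (\<Theta> + 1 - s)\<close> gives the accuracy by
  Chebyshev's argument.  The degree bounds are lower bounds on \<open>y\<close>, obtained from the averaging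
  equation.
\<close>

section \<open>PageRank on Eulerian graphs\<close>

text \<open>A minimum principle: at a minimiser \<open>w\<close> of \<open>h\<close> the average is
  at least \<open>h w\<close>, so the assumed inequality there collapses to
  \<open>\<alpha> * b \<le> \<alpha> * h w\<close>.\<close>

lemma lower_bound_of_averaging:
  fixes h :: "'a \<Rightarrow> real"
  assumes "finite V" and "\<alpha> > 0" and "\<alpha> < 1"
    and N: "\<And>v. v \<in> V \<Longrightarrow> N v \<subseteq> V" "\<And>v. v \<in> V \<Longrightarrow> card (N v) > 0"
    and h: "\<And>v. v \<in> V \<Longrightarrow> h v \<ge> \<alpha> * b + (1 - \<alpha>) * ((\<Sum>u\<in>N v. h u) / card (N v))"
    and "v \<in> V"
  shows "h v \<ge> b"
proof -
  define w where "w = arg_min_on h V"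
  have "V \<noteq> {}" using \<open>v \<in> V\<close> by auto
  have w: "w \<in> V" unfolding w_def using \<open>finite V\<close> \<open>V \<noteq> {}\<close> by (rule arg_min_if_finite)
  have le: "h w \<le> h u" if "u \<in> V" for u
    unfolding w_def using \<open>finite V\<close> \<open>V \<noteq> {}\<close> that by (rule arg_min_least)
  have "card (N w) * h w \<le> (\<Sum>u\<in>N w. h u)"
    by (rule sum_bounded_below) (use le N(1)[OF w] in auto)
  then have "h w \<le> (\<Sum>u\<in>N w. h u) / card (N w)"
    using N(2)[OF w] by (simp add: field_simps)
  then have "(1 - \<alpha>) * h w \<le> (1 - \<alpha>) * ((\<Sum>u\<in>N w. h u) / card (N w))"
    using \<open>\<alpha> < 1\<close> by (intro mult_left_mono) auto
  with h[OF w] have "\<alpha> * b \<le> \<alpha> * h w" by (simp add: algebra_simps)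
  then have "b \<le> h w" using \<open>\<alpha> > 0\<close> by simp
  with le[OF \<open>v \<in> V\<close>] show ?thesis by simp
qed

lemma upper_bound_of_averaging:
  fixes h :: "'a \<Rightarrow> real"
  assumes "finite V" and "\<alpha> > 0" and "\<alpha> < 1"
    and N: "\<And>v. v \<in> V \<Longrightarrow> N v \<subseteq> V" "\<And>v. v \<in> V \<Longrightarrow> card (N v) > 0"
    and h: "\<And>v. v \<in> V \<Longrightarrow> h v \<le> \<alpha> * b + (1 - \<alpha>) * ((\<Sum>u\<in>N v. h u) / card (N v))"
    and "v \<in> V"
  shows "h v \<le> b"
proof -
  have "- h v \<ge> - b"
    by (rule lower_bound_of_averaging[where V = V and N = N and h = "\<lambda>v. - h v"])
      (use assms in \<open>auto simp: sum_negf algebra_simps\<close>)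
  then show ?thesis by simp
qed

section \<open>In-neighbours and degrees\<close>

definition in_nbrs :: "nat pair_pre_digraph \<Rightarrow> nat \<Rightarrow> nat set" where
  "in_nbrs G v = {u. (u, v) \<in> parcs G}"

definition pagerank_density :: "nat pair_pre_digraph \<Rightarrow> real \<Rightarrow> nat \<Rightarrow> real" where
  "pagerank_density G \<alpha> v =
    real (order_of G) * vec_index (pagerank G \<alpha>) v / real (out_degree G v)"

locale eulerian_pagerank =
  fixes G :: "nat pair_pre_digraph" and \<alpha> :: real
  assumes labelled: "labelled_digraph G" and eulerian: "eulerian G"
    and min_degree_pos: "min_degree G > 0"
    and alpha_pos: "\<alpha> > 0" and alpha_less_1: "\<alpha> < 1"
begin

lemma fin: "pair_fin_digraph G" and verts: "pverts G = {..<order_of G}"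
  using labelled by (simp_all add: labelled_digraph_def)

lemma verts_iff: "v \<in> pverts G \<longleftrightarrow> v < order_of G"
  using verts by blast

lemma finite_verts: "finite (pverts G)" and finite_arcs: "finite (parcs G)"
  using fin by (simp_all add: pair_fin_digraph.pair_finite_verts pair_fin_digraph.pair_finite_arcs)

lemma wf: "pair_wf_digraph G"
  using fin by (simp add: pair_fin_digraph_def)

lemma min_degree_le: "v \<in> pverts G \<Longrightarrow> min_degree G \<le> out_degree G v"
  unfolding min_degree_def using finite_verts by (intro Min_le) auto

lemma max_degree_ge: "v \<in> pverts G \<Longrightarrow> out_degree G v \<le> max_degree G"
  unfolding max_degree_def using finite_verts by (intro Max_ge) auto

lemma degree_pos: "v \<in> pverts G \<Longrightarrow> out_degree G v > 0"
  using min_degree_le[of v] min_degree_pos by simp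

lemma in_nbrs_subset: "in_nbrs G v \<subseteq> pverts G"
  unfolding in_nbrs_def using pair_wf_digraph.in_arcsD1[OF wf] by auto

lemma finite_in_nbrs: "finite (in_nbrs G v)"
  using in_nbrs_subset finite_verts by (rule finite_subset)

text \<open>The Eulerian hypothesis enters here: it turns a sum over in-neighbours divided by the
  out-degree into an average.\<close>

lemma card_in_nbrs: "v \<in> pverts G \<Longrightarrow> card (in_nbrs G v) = out_degree G v"
proof -
  assume v: "v \<in> pverts G"
  have "in_arcs G v = (\<lambda>u. (u, v)) ` in_nbrs G v"
    by (auto simp: in_arcs_def in_nbrs_def)
  then have "in_degree G v = card (in_nbrs G v)"
    unfolding in_degree_def by (simp add: card_image inj_on_def)
  with eulerian v show ?thesis by (simp add: eulerian_def)
qed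

lemma card_in_nbrs_pos: "v \<in> pverts G \<Longrightarrow> card (in_nbrs G v) > 0"
  by (simp add: card_in_nbrs degree_pos)

lemma card_arcs: "card (parcs G) = (\<Sum>v\<in>pverts G. out_degree G v)"
proof -
  have "parcs G = (\<Union>v\<in>pverts G. (\<lambda>u. (u, v)) ` in_nbrs G v)"
    using pair_wf_digraph.in_arcsD2[OF wf] by (fastforce simp: in_nbrs_def)
  also have "card \<dots> = (\<Sum>v\<in>pverts G. card ((\<lambda>u. (u, v)) ` in_nbrs G v))"
    by (rule card_UN_disjoint) (auto simp: finite_verts finite_in_nbrs)
  also have "\<dots> = (\<Sum>v\<in>pverts G. out_degree G v)"
    by (rule sum.cong) (auto simp: card_image inj_on_def card_in_nbrs)
  finally show ?thesis .
qed

section \<open>Existence and uniqueness of the PageRank vector\<close>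

definition pagerank_mat :: "real mat" where
  "pagerank_mat = 1\<^sub>m (order_of G) - (1 - \<alpha>) \<cdot>\<^sub>m (transpose_mat (adjacency_mat G) * outdeg_mat_inv G)"

lemma pagerank_mat_carrier: "pagerank_mat \<in> carrier_mat (order_of G) (order_of G)"
  unfolding pagerank_mat_def adjacency_mat_def outdeg_mat_inv_def mat_diag_def by auto

lemma pagerank_mat_mult:
  assumes p: "p \<in> carrier_vec (order_of G)" and v: "v < order_of G"
  shows "vec_index (pagerank_mat *\<^sub>v p) v =
    vec_index p v - (1 - \<alpha>) * (\<Sum>u\<in>in_nbrs G v. vec_index p u / real (out_degree G u))"
proof -
  let ?n = "order_of G"
  let ?a = "\<lambda>u. if u \<in> in_nbrs G v then vec_index p u / real (out_degree G u) else 0"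
  have TD: "transpose_mat (adjacency_mat G) * outdeg_mat_inv G
    = Matrix.mat ?n ?n (\<lambda>(v, u). (if (u, v) \<in> parcs G then 1 else 0) / real (out_degree G u))"
    unfolding outdeg_mat_inv_def
    by (subst mat_diag_mult_right[where nr = ?n]) (auto simp: adjacency_mat_def intro!: eq_matI)
  have "vec_index (pagerank_mat *\<^sub>v p) v
    = (\<Sum>u<?n. ((if v = u then 1 else 0)
        - (1 - \<alpha>) * ((if (u, v) \<in> parcs G then 1 else 0) / real (out_degree G u))) * vec_index p u)"
    using p v unfolding pagerank_mat_def TD
    by (auto simp: scalar_prod_def atLeast0LessThan intro!: sum.cong)
  also have "\<dots> = (\<Sum>u<?n. (if u = v then vec_index p v else 0) - (1 - \<alpha>) * ?a u)"
    by (rule sum.cong) (auto simp: in_nbrs_def algebra_simps diff_divide_distrib)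
  also have "\<dots> = vec_index p v - (1 - \<alpha>) * (\<Sum>u<?n. ?a u)"
    using v by (simp add: sum_subtractf sum_distrib_left)
  also have "(\<Sum>u<?n. ?a u) = (\<Sum>u\<in>{..<?n} \<inter> in_nbrs G v. vec_index p u / real (out_degree G u))"
    by (simp add: sum.If_cases)
  also have "{..<?n} \<inter> in_nbrs G v = in_nbrs G v"
    using in_nbrs_subset[of v] by (auto simp: verts_iff)
  finally show ?thesis .
qed

text \<open>Divided by the degrees, a kernel vector solves the averaging equation with source term
  0, so the minimum and maximum principles with \<open>b = 0\<close> force it to vanish.\<close>

lemma pagerank_mat_kernel:
  assumes p: "p \<in> carrier_vec (order_of G)" and 0: "pagerank_mat *\<^sub>v p = 0\<^sub>v (order_of G)"
  shows "p = 0\<^sub>v (order_of G)"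
proof -
  define h where "h v = vec_index p v / real (out_degree G v)" for v
  have h: "h v = (1 - \<alpha>) * ((\<Sum>u\<in>in_nbrs G v. h u) / card (in_nbrs G v))" if "v \<in> pverts G" for v
  proof -
    have v: "v < order_of G" using that by (simp add: verts_iff)
    have "vec_index p v = (1 - \<alpha>) * (\<Sum>u\<in>in_nbrs G v. h u)"
      using pagerank_mat_mult[OF p v] 0 v by (simp add: h_def)
    then show ?thesis by (simp add: card_in_nbrs[OF that] h_def)
  qed
  have "h v = 0" if "v \<in> pverts G" for v
  proof (rule antisym)
    show "h v \<le> 0"
      by (rule upper_bound_of_averaging[where V = "pverts G" and N = "in_nbrs G" and \<alpha> = \<alpha>])
        (use h that in \<open>auto simp: finite_verts alpha_pos alpha_less_1 in_nbrs_subset card_in_nbrs_pos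
          dest!: subsetD[OF in_nbrs_subset]\<close>)
    show "h v \<ge> 0"
      by (rule lower_bound_of_averaging[where V = "pverts G" and N = "in_nbrs G" and \<alpha> = \<alpha>])
        (use h that in \<open>auto simp: finite_verts alpha_pos alpha_less_1 in_nbrs_subset card_in_nbrs_pos
          dest!: subsetD[OF in_nbrs_subset]\<close>)
  qed
  then have "vec_index p v = 0" if "v < order_of G" for v
    using that degree_pos[of v] by (fastforce simp: h_def verts_iff)
  with p show ?thesis by (intro eq_vecI) auto
qed

text \<open>A trivial kernel gives a nonzero determinant and hence a two-sided inverse
  \<open>B\<close>: one side yields a solution, the other its uniqueness, which together justify the
  definite description in \<open>pagerank\<close>.\<close>

lemma is_pagerank_pagerank: "is_pagerank G \<alpha> (pagerank G \<alpha>)"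
proof -
  let ?n = "order_of G"
  define b :: "real vec" where "b = (\<alpha> / real ?n) \<cdot>\<^sub>v Matrix.vec ?n (\<lambda>_. 1)"
  have b: "b \<in> carrier_vec ?n" by (simp add: b_def)
  have iff: "is_pagerank G \<alpha> p \<longleftrightarrow> p \<in> carrier_vec ?n \<and> pagerank_mat *\<^sub>v p = b" for p
    by (simp add: is_pagerank_def pagerank_mat_def b_def)
  have "Determinant.det pagerank_mat \<noteq> 0"
    using det_0_iff_vec_prod_zero_field[OF pagerank_mat_carrier] pagerank_mat_kernel by blast
  from det_non_zero_imp_unit[OF pagerank_mat_carrier this, of undefined]
  obtain B where B: "B \<in> carrier_mat ?n ?n" "B * pagerank_mat = 1\<^sub>m ?n" "pagerank_mat * B = 1\<^sub>m ?n"
    by (auto simp: Units_def ring_mat_def)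
  show ?thesis unfolding pagerank_def
  proof (rule theI)
    have "pagerank_mat *\<^sub>v (B *\<^sub>v b) = b"
      using assoc_mult_mat_vec[OF pagerank_mat_carrier B(1) b] B b by simp
    then show "is_pagerank G \<alpha> (B *\<^sub>v b)" using B b by (auto simp: iff)
    show "p = B *\<^sub>v b" if "is_pagerank G \<alpha> p" for p
      using assoc_mult_mat_vec[OF B(1) pagerank_mat_carrier, of p] B that by (simp add: iff)
  qed
qed

section \<open>Averaging equation and bounds for the PageRank density\<close>

abbreviation "y \<equiv> pagerank_density G \<alpha>"

lemma pagerank_eq:
  assumes "v \<in> pverts G"
  shows "real (order_of G) * vec_index (pagerank G \<alpha>) v = \<alpha> + (1 - \<alpha>) * (\<Sum>u\<in>in_nbrs G v. y u)"
proof -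
  let ?n = "order_of G"
  have v: "v < ?n" using assms by (simp add: verts_iff)
  have "vec_index (pagerank G \<alpha>) v
      - (1 - \<alpha>) * (\<Sum>u\<in>in_nbrs G v. vec_index (pagerank G \<alpha>) u / real (out_degree G u)) = \<alpha> / real ?n"
    using pagerank_mat_mult[OF _ v, of "pagerank G \<alpha>"] is_pagerank_pagerank v
    by (simp add: is_pagerank_def pagerank_mat_def)
  moreover have "(\<Sum>u\<in>in_nbrs G v. y u)
      = real ?n * (\<Sum>u\<in>in_nbrs G v. vec_index (pagerank G \<alpha>) u / real (out_degree G u))"
    by (simp add: pagerank_density_def sum_distrib_left)
  ultimately show ?thesis using v by (simp add: field_simps)
qed

lemma density_eq:
  assumes "v \<in> pverts G"
  shows "y v = \<alpha> / real (out_degree G v)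
    + (1 - \<alpha>) * ((\<Sum>u\<in>in_nbrs G v. y u) / card (in_nbrs G v))"
  using pagerank_eq[OF assms] degree_pos[OF assms] card_in_nbrs[OF assms]
  by (simp add: pagerank_density_def[of _ _ v] add_divide_distrib)

text \<open>The source term \<open>\<alpha> / d(v)\<close> is at most \<open>\<alpha>\<close> times
  the claimed bound, so the maximum principle applies. This is what makes \<open>success\<close> a
  probability.\<close>

lemma density_le:
  assumes "v \<in> pverts G"
  shows "y v \<le> 1 / real (min_degree G)"
proof (rule upper_bound_of_averaging[where V = "pverts G" and N = "in_nbrs G" and \<alpha> = \<alpha>])
  fix v assume v: "v \<in> pverts G"
  have "\<alpha> / real (out_degree G v) \<le> \<alpha> * (1 / real (min_degree G))"
    using min_degree_le[OF v] min_degree_pos alpha_pos by (simp add: frac_le)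
  with density_eq[OF v] show "y v \<le> \<alpha> * (1 / real (min_degree G))
      + (1 - \<alpha>) * ((\<Sum>u\<in>in_nbrs G v. y u) / card (in_nbrs G v))" by simp
qed (use assms in \<open>auto simp: finite_verts alpha_pos alpha_less_1 card_in_nbrs_pos
  dest!: subsetD[OF in_nbrs_subset]\<close>)

lemma density_ge:
  assumes "v \<in> pverts G"
  shows "y v \<ge> 1 / real (max_degree G)"
proof (rule lower_bound_of_averaging[where V = "pverts G" and N = "in_nbrs G" and \<alpha> = \<alpha>])
  fix v assume v: "v \<in> pverts G"
  have "\<alpha> / real (out_degree G v) \<ge> \<alpha> * (1 / real (max_degree G))"
    using max_degree_ge[OF v] degree_pos[OF v] alpha_pos by (simp add: frac_le)
  with density_eq[OF v] show "y v \<ge> \<alpha> * (1 / real (max_degree G))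
      + (1 - \<alpha>) * ((\<Sum>u\<in>in_nbrs G v. y u) / card (in_nbrs G v))" by simp
qed (use assms in \<open>auto simp: finite_verts alpha_pos alpha_less_1 card_in_nbrs_pos
  dest!: subsetD[OF in_nbrs_subset]\<close>)

lemma density_pos: "v \<in> pverts G \<Longrightarrow> y v > 0"
  using density_ge[of v] max_degree_ge[of v] degree_pos[of v]
  by (smt (verit) divide_pos_pos of_nat_0_less_iff order_less_le_trans)

text \<open>Keeps only the contribution of walks that stop at once; the average of the nonnegative
  density is dropped.\<close>

lemma density_ge_alpha:
  assumes "v \<in> pverts G"
  shows "y v \<ge> \<alpha> / real (out_degree G v)"
proof -
  have "(\<Sum>u\<in>in_nbrs G v. y u) \<ge> 0"
    using in_nbrs_subset density_pos by (intro sum_nonneg) (auto intro: less_imp_le)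
  with density_eq[OF assms] alpha_less_1 show ?thesis by simp
qed

text \<open>AM--HM over the in-neighbours, whose degrees sum to at most \<open>m\<close>.\<close>

lemma density_ge_degree:
  assumes v: "v \<in> pverts G"
  shows "y v \<ge> (1 - \<alpha>) * \<alpha> * real (out_degree G v) / real (card (parcs G))"
proof -
  let ?N = "in_nbrs G v" and ?d = "\<lambda>u. real (out_degree G u)" and ?m = "real (card (parcs G))"
  have dpos: "?d u > 0" if "u \<in> ?N" for u
    using in_nbrs_subset degree_pos that by auto
  have "(\<Sum>u\<in>?N. ?d u) \<le> (\<Sum>u\<in>pverts G. ?d u)"
    by (rule sum_mono2) (auto simp: finite_verts in_nbrs_subset)
  then have sm: "(\<Sum>u\<in>?N. ?d u) \<le> ?m" by (simp add: card_arcs)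
  \<comment> \<open>Each in-neighbour contributes 1 to the degree; writing this 1 as a product of
    two square roots prepares Cauchy-Schwarz.\<close>
  have "?d v = (\<Sum>u\<in>?N. sqrt (1 / ?d u) * sqrt (?d u))"
    using dpos card_in_nbrs[OF v] by (simp add: real_sqrt_mult[symmetric] less_imp_neq[symmetric])
  then have "(?d v)\<^sup>2 \<le> (\<Sum>u\<in>?N. (sqrt (1 / ?d u))\<^sup>2) * (\<Sum>u\<in>?N. (sqrt (?d u))\<^sup>2)"
    by (simp only: Cauchy_Schwarz_ineq_sum)
  also have "\<dots> = (\<Sum>u\<in>?N. 1 / ?d u) * (\<Sum>u\<in>?N. ?d u)"
    by simp
  also have "\<dots> \<le> (\<Sum>u\<in>?N. 1 / ?d u) * ?m"
    using sm by (intro mult_left_mono sum_nonneg) auto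
  finally have AMHM: "(?d v)\<^sup>2 \<le> (\<Sum>u\<in>?N. 1 / ?d u) * ?m" .
  have "?m > 0"
    using sm sum_pos[of ?N ?d] dpos card_in_nbrs_pos[OF v] finite_in_nbrs[of v] by fastforce
  with AMHM have "(?d v)\<^sup>2 / ?m \<le> (\<Sum>u\<in>?N. 1 / ?d u)" by (simp add: divide_le_eq)
  then have "\<alpha> * ((?d v)\<^sup>2 / ?m) \<le> \<alpha> * (\<Sum>u\<in>?N. 1 / ?d u)"
    using alpha_pos by (intro mult_left_mono) auto
  also have "\<dots> \<le> (\<Sum>u\<in>?N. y u)"
    unfolding sum_distrib_left
    by (rule sum_mono) (use density_ge_alpha in_nbrs_subset in \<open>force\<close>)
  finally have "(1 - \<alpha>) * (\<alpha> * ((?d v)\<^sup>2 / ?m)) \<le> (1 - \<alpha>) * (\<Sum>u\<in>?N. y u)"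
    using alpha_less_1 by (intro mult_left_mono) auto
  also have "\<dots> \<le> y v * ?d v"
    using pagerank_eq[OF v] degree_pos[OF v] alpha_pos by (simp add: pagerank_density_def[of _ _ v])
  finally have "((1 - \<alpha>) * \<alpha> * ?d v / ?m) * ?d v \<le> y v * ?d v"
    by (simp add: power2_eq_square mult_ac)
  then show ?thesis using degree_pos[OF v] by (simp only: mult_le_cancel_right_pos of_nat_0_less_iff)
qed

text \<open>
  Fewer than \<open>sqrt m / 2\<close> vertices have degree above \<open>2 sqrt m\<close>, so at least half of the
  in-neighbours of such a vertex have small degree.  Compare the equation at a minimiser of the
  density with the equations at these in-neighbours.
\<close>

lemma density_ge_sqrt:
  assumes v: "v \<in> pverts G"
  shows "y v \<ge> (1 - \<alpha>) / (6 * sqrt (card (parcs G)))"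
proof -
  define q where "q = sqrt (card (parcs G))"
  define w where "w = arg_min_on y (pverts G)"
  have ne: "pverts G \<noteq> {}" using v by auto
  have w: "w \<in> pverts G" unfolding w_def using finite_verts ne by (rule arg_min_if_finite)
  have le: "y w \<le> y u" if "u \<in> pverts G" for u
    unfolding w_def using finite_verts ne that by (rule arg_min_least)
  let ?d = "\<lambda>u. real (out_degree G u)" and ?N = "in_nbrs G w"
  have m: "real (card (parcs G)) = (\<Sum>u\<in>pverts G. ?d u)" by (simp add: card_arcs)
  have "card (parcs G) > 0"
    using card_in_nbrs_pos[OF v] finite_arcs by (auto simp: card_gt_0_iff in_nbrs_def)
  then have q: "q > 0" "q * q = real (card (parcs G))" by (simp_all add: q_def)
  have a: "0 < \<alpha>" "\<alpha> < 1" by (rule alpha_pos alpha_less_1)+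
  have avg: "(\<Sum>u\<in>in_nbrs G u'. y u) / card (in_nbrs G u') \<ge> y w" if "u' \<in> pverts G" for u'
    using sum_bounded_below[of "in_nbrs G u'" "y w" y] le in_nbrs_subset[of u'] card_in_nbrs_pos[OF that]
    by (auto simp: field_simps)
  have low: "y u \<ge> \<alpha> / (2 * q) + (1 - \<alpha>) * y w" if u: "u \<in> pverts G" "?d u \<le> 2 * q" for u
  proof -
    have "\<alpha> / (2 * q) \<le> \<alpha> / ?d u" using u degree_pos[of u] a by (simp add: frac_le)
    moreover have "(1 - \<alpha>) * y w \<le> (1 - \<alpha>) * ((\<Sum>u\<in>in_nbrs G u. y u) / card (in_nbrs G u))"
      using avg[OF u(1)] a by (intro mult_left_mono) auto
    ultimately show ?thesis using density_eq[OF u(1)] by linarith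
  qed
  have "y w \<ge> (1 - \<alpha>) / (6 * q)"
  proof (cases "?d w \<le> 2 * q")
    case True
    from low[OF w this] have "\<alpha> / (2 * q) \<le> \<alpha> * y w" by (simp add: algebra_simps)
    then have "\<alpha> * (1 / (2 * q)) \<le> \<alpha> * y w" by simp
    then have "1 / (2 * q) \<le> y w" using a by (simp only: mult_le_cancel_left_pos)
    moreover have "(1 - \<alpha>) / (6 * q) \<le> 1 / (2 * q)" using a q by (simp add: field_simps)
    ultimately show ?thesis by simp
  next
    case False
    define H where "H = {u \<in> pverts G. ?d u > 2 * q}"
    define B where "B = {u \<in> ?N. ?d u \<le> 2 * q}"
    have fin: "finite H" "finite B" "finite ?N"
      using finite_verts finite_in_nbrs[of w] by (auto simp: H_def B_def)
    have "card H * (2 * q) \<le> (\<Sum>u\<in>H. ?d u)"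
      by (rule sum_bounded_below) (auto simp: H_def)
    also have "\<dots> \<le> q * q"
      unfolding q(2) m by (rule sum_mono2) (auto simp: finite_verts H_def)
    finally have "q * (2 * real (card H)) \<le> q * q" by (simp add: mult_ac)
    then have cH: "real (card H) \<le> q / 2" using q(1) by (simp add: mult_le_cancel_left_pos)
    have "?N \<subseteq> B \<union> H" using in_nbrs_subset[of w] by (auto simp: B_def H_def)
    then have "card ?N \<le> card (B \<union> H)" by (rule card_mono[rotated]) (use fin in auto)
    also have "\<dots> \<le> card B + card H" by (rule card_Un_le)
    finally have "?d w \<le> real (card B) + real (card H)" by (simp add: card_in_nbrs[OF w])
    with cH False have cB: "real (card B) \<ge> ?d w / 2" using q by simp
    \<comment> \<open>By \<open>low\<close>, the amount by which the density at an in-neighbour of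
      small degree is known to exceed the minimum \<open>y w\<close>. If it is not positive, the
      minimum is already large enough.\<close>
    define \<beta> where "\<beta> = \<alpha> / (2 * q) - \<alpha> * y w"
    have "y w * ?d w + card B * \<beta> = (\<Sum>u\<in>?N. y w + (if u \<in> B then \<beta> else 0))"
      using fin by (simp add: sum.distrib sum.If_cases card_in_nbrs[OF w] B_def Int_def)
    also have "\<dots> \<le> (\<Sum>u\<in>?N. y u)"
    proof (rule sum_mono)
      fix u assume "u \<in> ?N"
      then have "u \<in> pverts G" using in_nbrs_subset by auto
      then show "y w + (if u \<in> B then \<beta> else 0) \<le> y u"
        using le[of u] low[of u] by (auto simp: B_def \<beta>_def algebra_simps)
    qed
    finally have S: "y w * ?d w + card B * \<beta> \<le> (\<Sum>u\<in>?N. y u)" .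
    show ?thesis
    proof (cases "\<beta> \<le> 0")
      case True
      then have "\<alpha> * (1 / (2 * q)) \<le> \<alpha> * y w" by (simp add: \<beta>_def)
      then have "1 / (2 * q) \<le> y w" using a by (simp only: mult_le_cancel_left_pos)
      moreover have "(1 - \<alpha>) / (6 * q) \<le> 1 / (2 * q)" using a q by (simp add: field_simps)
      ultimately show ?thesis by simp
    next
      case False
      then have "?d w / 2 * \<beta> \<le> card B * \<beta>" using cB by (intro mult_right_mono) auto
      with S have "(y w + \<beta> / 2) * ?d w \<le> (\<Sum>u\<in>?N. y u)" by (simp add: algebra_simps)
      then have "y w + \<beta> / 2 \<le> (\<Sum>u\<in>?N. y u) / card ?N"
        using degree_pos[OF w] by (simp add: card_in_nbrs[OF w] pos_le_divide_eq)
      then have "(1 - \<alpha>) * (y w + \<beta> / 2) \<le> (1 - \<alpha>) * ((\<Sum>u\<in>?N. y u) / card ?N)"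
        using a by (intro mult_left_mono) auto
      also have "\<dots> \<le> y w" using density_eq[OF w] a by simp
      \<comment> \<open>The coefficient of \<open>y w\<close> left after collecting terms is
        \<open>1 - (1 - \<alpha>) * (1 - \<alpha> / 2) = \<alpha> * (3 - \<alpha>) / 2\<close>, so a
        factor \<open>\<alpha>\<close> cancels. Bounding \<open>3 - \<alpha>\<close> by 3 produces
        the constant 6.\<close>
      finally have "\<alpha> * ((1 - \<alpha>) / (2 * q)) \<le> \<alpha> * ((3 - \<alpha>) * y w)"
        by (simp add: \<beta>_def field_simps)
      then have "(1 - \<alpha>) / (2 * q) \<le> (3 - \<alpha>) * y w"
        using a by (simp only: mult_le_cancel_left_pos)
      also have "\<dots> \<le> 3 * y w" using a density_pos[OF w] by (simp add: field_simps)
      finally show ?thesis by (simp add: field_simps)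
    qed
  qed
  with le[OF v] show ?thesis by (simp add: q_def)
qed

section \<open>Comparison of the two time bounds\<close>

lemma pagerank_time_bound_eq:
  assumes t: "t \<in> pverts G"
  shows "pagerank_time_bound G \<alpha> t \<epsilon> = 1 / (\<alpha> * \<epsilon>\<^sup>2 * (real (min_degree G) * y t))"
  using degree_pos[OF t] by (simp add: pagerank_time_bound_def pagerank_density_def)

text \<open>Each of the four lower bounds on \<open>y t\<close> yields one entry of the minimum.
  Those involving \<open>m\<close> lose a factor \<open>1 - \<alpha>\<close>, the last one also a
  factor 6, which explains the constant.\<close>

lemma pagerank_time_bound_le:
  assumes t: "t \<in> pverts G"
  shows "pagerank_time_bound G \<alpha> t \<epsilon> \<le> 6 / (1 - \<alpha>) * degree_time_bound G \<alpha> t \<epsilon>"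
proof -
  define d where "d = real (out_degree G t)"
  define m where "m = real (card (parcs G))"
  define \<Delta> where "\<Delta> = real (max_degree G)"
  define S where "S = {d / \<alpha>\<^sup>2, (m / d) / \<alpha>\<^sup>2, \<Delta> / \<alpha>, sqrt m / \<alpha>}"
  note a = alpha_pos alpha_less_1 and y = density_pos[OF t]
  have d: "d > 0" using degree_pos[OF t] by (simp add: d_def)
  have \<Delta>: "\<Delta> > 0" using max_degree_ge[OF t] d by (simp add: d_def \<Delta>_def)
  have "card (parcs G) > 0"
    using card_in_nbrs_pos[OF t] finite_arcs by (auto simp: card_gt_0_iff in_nbrs_def)
  then have m: "m > 0" by (simp add: m_def)
  have y_ge: "y t \<ge> \<alpha> / d" "y t \<ge> (1 - \<alpha>) * \<alpha> * d / m" "y t \<ge> 1 / \<Delta>" "y t \<ge> (1 - \<alpha>) / (6 * sqrt m)"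
    using density_ge_alpha[OF t] density_ge_degree[OF t] density_ge[OF t] density_ge_sqrt[OF t]
    by (simp_all add: d_def m_def \<Delta>_def)
  have C: "6 / (1 - \<alpha>) \<ge> 1" using a by (simp add: field_simps)
  \<comment> \<open>\<open>bound\<close> serves the lower bounds without loss, \<open>bound'\<close>
    those that lose a factor of at most \<open>6 / (1 - \<alpha>)\<close>.\<close>
  have bound: "1 / (\<alpha> * y t) \<le> 6 / (1 - \<alpha>) * (1 / (\<alpha> * z))" if "y t \<ge> z" "z > 0" for z
  proof -
    have "1 / (\<alpha> * y t) \<le> 1 * (1 / (\<alpha> * z))"
      using that a y by (simp add: frac_le)
    also have "\<dots> \<le> 6 / (1 - \<alpha>) * (1 / (\<alpha> * z))"
      using C that a by (intro mult_right_mono) auto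
    finally show ?thesis .
  qed
  have bound': "1 / (\<alpha> * y t) \<le> 6 / (1 - \<alpha>) * (1 / (\<alpha> * z))" if "y t \<ge> (1 - \<alpha>) / 6 * z" "z > 0" for z
  proof -
    have "1 / (\<alpha> * y t) \<le> 1 / (\<alpha> * ((1 - \<alpha>) / 6 * z))"
      using that a y by (intro frac_le mult_left_mono mult_pos_pos) auto
    then show ?thesis by (simp add: mult_ac)
  qed
  have "Min S \<in> S" unfolding S_def by (rule Min_in) auto
  moreover have "1 / (\<alpha> * y t) \<le> 6 / (1 - \<alpha>) * (d / \<alpha>\<^sup>2)"
    using bound[OF y_ge(1)] a d by (simp add: power2_eq_square)
  moreover have "1 / (\<alpha> * y t) \<le> 6 / (1 - \<alpha>) * ((m / d) / \<alpha>\<^sup>2)"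
  proof -
    have "(1 - \<alpha>) / 6 * (\<alpha> * d / m) \<le> y t"
      using y_ge(2) a d m by (intro order_trans[OF _ y_ge(2)]) (simp add: field_simps)
    from bound'[OF this] a d m show ?thesis by (simp add: power2_eq_square mult_ac)
  qed
  moreover have "1 / (\<alpha> * y t) \<le> 6 / (1 - \<alpha>) * (\<Delta> / \<alpha>)"
    using bound[OF y_ge(3)] a \<Delta> by simp
  moreover have "1 / (\<alpha> * y t) \<le> 6 / (1 - \<alpha>) * (sqrt m / \<alpha>)"
    using bound'[of "1 / sqrt m"] y_ge(4) m by simp
  ultimately have "1 / (\<alpha> * y t) \<le> 6 / (1 - \<alpha>) * Min S"
    unfolding S_def by fastforce
  then have "1 / (\<epsilon>\<^sup>2 * real (min_degree G)) * (1 / (\<alpha> * y t))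
      \<le> 1 / (\<epsilon>\<^sup>2 * real (min_degree G)) * (6 / (1 - \<alpha>) * Min S)"
    by (rule mult_left_mono) auto
  then show ?thesis
    by (simp add: pagerank_time_bound_eq[OF t] degree_time_bound_def Let_def mult_ac S_def
        d_def m_def \<Delta>_def)
qed

end

section \<open>Bounded-horizon costs of programs\<close>

text \<open>
  The expected cost of the first \<open>k\<close> steps, where every step costs \<open>a\<close> and a configuration \<open>c\<close>
  reached on halting costs \<open>f c\<close>.  Both the running time (\<open>a = 1\<close>, \<open>f = 0\<close>) and the failure
  probability (\<open>a = 0\<close>, \<open>f\<close> an indicator) are of this form.
\<close>

primrec accumulated ::
  "adj_lists \<Rightarrow> instr list \<Rightarrow> ennreal \<Rightarrow> (config \<Rightarrow> ennreal) \<Rightarrow> nat \<Rightarrow> config \<Rightarrow> ennreal" where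
  "accumulated L P a f 0 c = (if halted P c then f c else 0)"
| "accumulated L P a f (Suc k) c = (if halted P c then f c
     else a + (\<integral>\<^sup>+ c'. accumulated L P a f k c' \<partial>measure_pmf (exec L (P ! pc c) c)))"

lemma accumulated_halted: "halted P c \<Longrightarrow> accumulated L P a f k c = f c"
  by (cases k) auto

lemma accumulated_step:
  "pc c < length P \<Longrightarrow> accumulated L P a f (Suc k) c
    = a + (\<integral>\<^sup>+ c'. accumulated L P a f k c' \<partial>measure_pmf (exec L (P ! pc c) c))"
  by (simp add: halted_def)

lemma accumulated_Suc: "accumulated L P a f k c \<le> accumulated L P a f (Suc k) c"
proof (induction k arbitrary: c)
  case (Suc k)
  have "(\<integral>\<^sup>+ c'. accumulated L P a f k c' \<partial>measure_pmf (exec L (P ! pc c) c))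
      \<le> (\<integral>\<^sup>+ c'. accumulated L P a f (Suc k) c' \<partial>measure_pmf (exec L (P ! pc c) c))"
    by (intro nn_integral_mono Suc.IH)
  then show ?case
    by (simp only: accumulated.simps(2)[of _ _ _ _ "Suc k"] accumulated.simps(2)[of _ _ _ _ k c])
      (auto intro: add_left_mono)
qed simp

text \<open>Used to raise the horizon by the length of a block of instructions: after symbolic
  execution of the block the horizon is back at its old value.\<close>

lemma accumulated_mono: "k \<le> l \<Longrightarrow> accumulated L P a f k c \<le> accumulated L P a f l c"
  by (rule lift_Suc_mono_le[of "\<lambda>k. accumulated L P a f k c"]) (rule accumulated_Suc)

section \<open>Probabilities of runs as accumulated costs\<close>

lemma run_halted: "halted P c \<Longrightarrow> run L P k c = return_pmf c"
  by (induction k) (simp_all add: step_def bind_return_pmf)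

lemma prob_run_Suc:
  "\<not> halted P c \<Longrightarrow> ennreal (measure_pmf.prob (run L P (Suc k) c) A)
    = (\<integral>\<^sup>+ c'. ennreal (measure_pmf.prob (run L P k c') A) \<partial>measure_pmf (exec L (P ! pc c) c))"
  by (simp add: step_def measure_pmf.emeasure_eq_measure[symmetric] emeasure_bind_pmf)

text \<open>Both sides are the expectation of the running time truncated at \<open>k\<close>. The
  induction splits off the first step, on the left by an index shift.\<close>

lemma sum_prob_running:
  "(\<Sum>j<k. ennreal (measure_pmf.prob (run L P j c) {c'. \<not> halted P c'}))
    = accumulated L P 1 (\<lambda>_. 0) k c"
proof (induction k arbitrary: c)
  case (Suc k)
  show ?case
  proof (cases "halted P c")
    case True
    then show ?thesis by (simp add: run_halted del: run.simps sum.lessThan_Suc)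
  next
    case False
    then have "(\<Sum>j<Suc k. ennreal (measure_pmf.prob (run L P j c) {c'. \<not> halted P c'}))
      = 1 + (\<Sum>j<k. ennreal (measure_pmf.prob (run L P (Suc j) c) {c'. \<not> halted P c'}))"
      by (simp add: sum.lessThan_Suc_shift del: run.simps(2) sum.lessThan_Suc)
    also have "\<dots> = 1 + (\<integral>\<^sup>+ c'. (\<Sum>j<k. ennreal (measure_pmf.prob (run L P j c') {c'. \<not> halted P c'}))
        \<partial>measure_pmf (exec L (P ! pc c) c))"
      by (simp add: prob_run_Suc[OF False] nn_integral_sum del: run.simps sum_ennreal)
    finally show ?thesis using False by (simp add: Suc.IH)
  qed
qed simp

lemma prob_halted:
  "ennreal (measure_pmf.prob (run L P k c) {c'. halted P c' \<and> Q c'})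
    = accumulated L P 0 (\<lambda>c. indicator {c. Q c} c) k c"
proof (induction k arbitrary: c)
  case 0
  show ?case by (auto simp: indicator_def)
next
  case (Suc k)
  show ?case
  proof (cases "halted P c")
    case True
    then show ?thesis by (auto simp add: run_halted indicator_def simp del: run.simps)
  next
    case False
    then show ?thesis by (simp only: prob_run_Suc[OF False] Suc.IH) simp
  qed
qed

lemma prob_running_Suc:
  "measure_pmf.prob (run L P (Suc k) c) {c'. \<not> halted P c'}
    \<le> measure_pmf.prob (run L P k c) {c'. \<not> halted P c'}"
proof -
  have "ennreal (measure_pmf.prob (run L P (Suc k) c) {c'. \<not> halted P c'})
    \<le> ennreal (measure_pmf.prob (run L P k c) {c'. \<not> halted P c'})"
  proof (induction k arbitrary: c)
    case 0
    show ?case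
      by (cases "halted P c") (simp_all only: run_halted order_refl, simp)
  next
    case (Suc k)
    show ?case
    proof (cases "halted P c")
      case False
      show ?thesis unfolding prob_run_Suc[OF False] by (intro nn_integral_mono Suc.IH)
    qed (simp add: run_halted del: run.simps)
  qed
  then show ?thesis by (simp add: ennreal_le_iff)
qed

lemma expected_time_le:
  assumes "\<And>k. accumulated L P 1 (\<lambda>_. 0) k c \<le> b"
  shows "expected_time L P c \<le> b"
  unfolding expected_time_def suminf_eq_SUP sum_prob_running using assms by (rule SUP_least)

text \<open>Markov's inequality in tail-sum form: the probabilities of still running decrease, so
  each of the first \<open>Suc k\<close> terms of the expected time is at least the last of
  them.\<close>

lemma prob_running_le:
  assumes "expected_time L P c \<le> ennreal b" and "b \<ge> 0"
  shows "real (Suc k) * measure_pmf.prob (run L P k c) {c'. \<not> halted P c'} \<le> b"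
proof -
  define r where "r j = measure_pmf.prob (run L P j c) {c'. \<not> halted P c'}" for j
  have "antimono r" unfolding r_def by (intro decseq_SucI prob_running_Suc)
  then have "real (Suc k) * r k \<le> (\<Sum>j<Suc k. r j)"
    using sum_bounded_below[of "{..<Suc k}" "r k" r] by (auto simp: antimono_def)
  moreover have "ennreal (\<Sum>j<Suc k. r j) \<le> ennreal b"
  proof -
    have "ennreal (\<Sum>j<Suc k. r j) = (\<Sum>j<Suc k. ennreal (r j))"
      by (rule sum_ennreal[symmetric]) (simp add: r_def)
    also have "\<dots> \<le> (\<Sum>j. ennreal (r j))" by (rule sum_le_suminf) auto
    also have "\<dots> \<le> ennreal b" using assms(1) by (simp add: expected_time_def r_def)
    finally show ?thesis .
  qed
  ultimately show ?thesis using \<open>b \<ge> 0\<close> by (simp add: r_def ennreal_le_iff)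
qed

text \<open>The failure budget of 1/4 is split into 1/16 for not halting in time, by Markov, and
  3/16 for halting with a bad output.\<close>

lemma succeeds_withinI:
  assumes time: "expected_time L P c \<le> ennreal (T / 16)" and "T \<ge> 0"
    and bad: "\<And>k. accumulated L P 0 (indicator {c. \<bar>result c - x\<bar> > \<epsilon> * x}) k c \<le> ennreal (3 / 16)"
  shows "succeeds_within L P c x \<epsilon> T (3 / 4)"
proof -
  define k where "k = nat \<lfloor>T\<rfloor>"
  let ?p = "measure_pmf.prob (run L P k c)"
  have "?p {c'. \<not> halted P c'} \<le> 1 / 16"
  proof (cases "T = 0")
    case True
    with prob_running_le[OF time, of k] show ?thesis
      by (simp add: mult_le_0_iff)
  next
    case False
    \<comment> \<open>The extra term in \<open>Suc k\<close> makes up for rounding \<open>T\<close>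
      down.\<close>
    have "T * ?p {c'. \<not> halted P c'} \<le> real (Suc k) * ?p {c'. \<not> halted P c'}"
      using \<open>T \<ge> 0\<close> by (intro mult_right_mono) (simp_all add: k_def, linarith)
    also have "\<dots> \<le> T * (1 / 16)"
      using prob_running_le[OF time, of k] \<open>T \<ge> 0\<close> by simp
    finally show ?thesis using False \<open>T \<ge> 0\<close> by (simp only: mult_le_cancel_left)
  qed
  moreover have "?p {c'. halted P c' \<and> \<bar>result c' - x\<bar> > \<epsilon> * x} \<le> 3 / 16"
    using bad[of k] by (simp add: prob_halted[symmetric] ennreal_le_iff)
  moreover have "1 \<le> ?p {c'. halted P c' \<and> \<bar>result c' - x\<bar> \<le> \<epsilon> * x} +
     (?p {c'. \<not> halted P c'} + ?p {c'. halted P c' \<and> \<bar>result c' - x\<bar> > \<epsilon> * x})"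
  proof -
    have "1 = ?p ({c'. halted P c' \<and> \<bar>result c' - x\<bar> \<le> \<epsilon> * x} \<union>
       ({c'. \<not> halted P c'} \<union> {c'. halted P c' \<and> \<bar>result c' - x\<bar> > \<epsilon> * x}))"
      by (subst eq_commute) (auto simp: measure_pmf.prob_eq_1)
    also have "\<dots> \<le> ?p {c'. halted P c' \<and> \<bar>result c' - x\<bar> \<le> \<epsilon> * x} +
       ?p ({c'. \<not> halted P c'} \<union> {c'. halted P c' \<and> \<bar>result c' - x\<bar> > \<epsilon> * x})"
      by (rule measure_Un_le) auto
    also have "?p ({c'. \<not> halted P c'} \<union> {c'. halted P c' \<and> \<bar>result c' - x\<bar> > \<epsilon> * x})
      \<le> ?p {c'. \<not> halted P c'} + ?p {c'. halted P c' \<and> \<bar>result c' - x\<bar> > \<epsilon> * x}"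
      by (rule measure_Un_le) auto
    finally show ?thesis by simp
  qed
  ultimately show ?thesis unfolding succeeds_within_def k_def by simp
qed

section \<open>The program and its analysis\<close>

text \<open>
  Registers: natural cell 5 holds the current vertex of the walk; real cells 3, 5, 6 and 7 hold
  the threshold \<open>\<Theta>\<close>, the number of successes, the number of rounds and \<open>\<delta>\<close>.  A round starts at
  address 7, a step of the walk at 9, the coin at the end of the walk at 15 and the computation of
  the output at 23.
\<close>

definition pagerank_prog :: "instr list" where
  "pagerank_prog =
   [NConst 3 1,
    ROfNat 2 3,
    NConst 4 24,
    ROfNat 3 4,
    RMul 4 1 1,
    RDiv 3 3 4,
    ROfNat 7 2,
    NMove 5 1,
    RAdd 6 6 2,
    Coin 6 0,
    JumpNLe 3 6 15,
    InDeg 7 5,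
    Uniform 8 7,
    InNbr 5 5 8,
    Jump 9,
    InDeg 7 5,
    ROfNat 8 7,
    RDiv 8 7 8,
    Coin 6 8,
    ROfNat 8 6,
    RAdd 5 5 8,
    JumpRLe 3 5 23,
    Jump 7,
    InDeg 7 1,
    ROfNat 8 7,
    RDiv 8 8 7,
    ROfNat 9 0,
    RDiv 8 8 9,
    RMul 8 8 5,
    RDiv 0 8 6]"

lemma length_pagerank_prog: "length pagerank_prog = 30"
  by (simp add: pagerank_prog_def)

lemma pagerank_prog_nth:
  "pagerank_prog ! 0 = NConst 3 1"
  "pagerank_prog ! Suc 0 = ROfNat 2 3"
  "pagerank_prog ! 2 = NConst 4 24"
  "pagerank_prog ! 3 = ROfNat 3 4"
  "pagerank_prog ! 4 = RMul 4 1 1"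
  "pagerank_prog ! 5 = RDiv 3 3 4"
  "pagerank_prog ! 6 = ROfNat 7 2"
  "pagerank_prog ! 7 = NMove 5 1"
  "pagerank_prog ! 8 = RAdd 6 6 2"
  "pagerank_prog ! 9 = Coin 6 0"
  "pagerank_prog ! 10 = JumpNLe 3 6 15"
  "pagerank_prog ! 11 = InDeg 7 5"
  "pagerank_prog ! 12 = Uniform 8 7"
  "pagerank_prog ! 13 = InNbr 5 5 8"
  "pagerank_prog ! 14 = Jump 9"
  "pagerank_prog ! 15 = InDeg 7 5"
  "pagerank_prog ! 16 = ROfNat 8 7"
  "pagerank_prog ! 17 = RDiv 8 7 8"
  "pagerank_prog ! 18 = Coin 6 8"
  "pagerank_prog ! 19 = ROfNat 8 6"
  "pagerank_prog ! 20 = RAdd 5 5 8"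
  "pagerank_prog ! 21 = JumpRLe 3 5 23"
  "pagerank_prog ! 22 = Jump 7"
  "pagerank_prog ! 23 = InDeg 7 1"
  "pagerank_prog ! 24 = ROfNat 8 7"
  "pagerank_prog ! 25 = RDiv 8 8 7"
  "pagerank_prog ! 26 = ROfNat 9 0"
  "pagerank_prog ! 27 = RDiv 8 8 9"
  "pagerank_prog ! 28 = RMul 8 8 5"
  "pagerank_prog ! 29 = RDiv 0 8 6"
  by (simp_all add: pagerank_prog_def)

lemma set_nat_simps [simp]:
  "pc (set_nat a x c) = Suc (pc c)" "nmem (set_nat a x c) = (nmem c)(a := x)"
  "rmem (set_nat a x c) = rmem c"
  by (simp_all add: set_nat_def)

lemma set_real_simps [simp]:
  "pc (set_real a x c) = Suc (pc c)" "nmem (set_real a x c) = nmem c"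
  "rmem (set_real a x c) = (rmem c)(a := x)"
  by (simp_all add: set_real_def)

lemma branch_simps [simp]:
  "pc (branch b l c) = (if b then l else Suc (pc c))" "nmem (branch b l c) = nmem c"
  "rmem (branch b l c) = rmem c"
  by (simp_all add: branch_def)

section \<open>The success probability of a round and the loop invariant\<close>

locale pagerank_query = eulerian_pagerank +
  fixes L :: adj_lists and \<epsilon> :: real and t :: nat
  assumes represents: "represents L G" and eps_pos: "\<epsilon> > 0" and eps_le_1: "\<epsilon> \<le> 1"
    and target: "t \<in> pverts G"
begin

lemma set_in_list: "set (in_list L v) = in_nbrs G v" and distinct_in_list: "distinct (in_list L v)"
  using represents by (auto simp: represents_def in_nbrs_def)

lemma length_in_list: "v \<in> pverts G \<Longrightarrow> length (in_list L v) = out_degree G v"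
  using distinct_card[OF distinct_in_list[of v]] by (simp add: set_in_list card_in_nbrs)

lemma sum_in_list:
  "v \<in> pverts G \<Longrightarrow> (\<Sum>i<out_degree G v. h (in_list L v ! i)) = (\<Sum>u\<in>in_nbrs G v. h u)"
  using sum.reindex_bij_betw[OF bij_betw_nth[OF distinct_in_list refl refl], of h v]
  by (simp add: set_in_list length_in_list)

definition success :: "nat \<Rightarrow> real" where
  "success v = real (min_degree G) * y v"

text \<open>The first-step equation of a round: stop at \<open>v\<close> with probability
  \<open>\<alpha>\<close> and toss a coin of bias \<open>\<delta> / d(v)\<close>, or else move to a
  uniform in-neighbour.\<close>

lemma success_eq:
  assumes "v \<in> pverts G"
  shows "success v = \<alpha> * (real (min_degree G) / real (out_degree G v))
    + (1 - \<alpha>) * ((\<Sum>u\<in>in_nbrs G v. success u) / real (out_degree G v))"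
  using density_eq[OF assms] card_in_nbrs[OF assms]
  by (simp add: success_def sum_distrib_left[symmetric] distrib_left mult_ac)

lemma success_pos: "v \<in> pverts G \<Longrightarrow> success v > 0"
  using density_pos[of v] min_degree_pos by (simp add: success_def)

lemma success_le_1: "v \<in> pverts G \<Longrightarrow> success v \<le> 1"
  using density_le[of v] min_degree_pos by (simp add: success_def field_simps)

text \<open>The constant 24 makes the square of \<open>\<epsilon> * \<Theta> / 2\<close> equal to
  \<open>6 * \<Theta>\<close>; the failure bound \<open>(\<Theta> + 1) / (6 * \<Theta>)\<close> is
  then at most 25/144, which is below 3/16.\<close>

definition \<Theta> :: real where "\<Theta> = 24 / \<epsilon>\<^sup>2"

lemma Theta_ge: "\<Theta> \<ge> 24"
  using eps_pos eps_le_1 by (simp add: \<Theta>_def field_simps power_le_one)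

text \<open>The number 1 is kept in natural cell 3 for testing the stopping coin and in real cell 2
  for counting rounds. The current vertex is left out because it changes during a walk.\<close>

definition loop_state :: "config \<Rightarrow> real \<Rightarrow> real \<Rightarrow> bool" where
  "loop_state c N s \<longleftrightarrow> nmem c 0 = order_of G \<and> nmem c (Suc 0) = t \<and> nmem c 3 = 1 \<and>
    rmem c 0 = \<alpha> \<and> rmem c 2 = 1 \<and> rmem c 3 = \<Theta> \<and> rmem c 5 = s \<and> rmem c 6 = N \<and>
    rmem c 7 = real (min_degree G)"

text \<open>Solves \<open>success t = \<delta> n \<pi>(t) / d(t)\<close> for
  \<open>\<pi>(t)\<close>, with \<open>s / N\<close> in place of the success probability; the order
  of operations is that of the program.\<close>

definition estimate :: "real \<Rightarrow> real \<Rightarrow> real" where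
  "estimate N s = real (out_degree G t) / real (min_degree G) / real (order_of G) * s / N"

end

text \<open>
  \<open>F N s\<close> bounds the cost from the start of a round, after \<open>N\<close> rounds and \<open>s\<close> successes.  As \<open>s\<close>
  stays below \<open>\<Theta>\<close> until the last round, it never exceeds \<open>\<Theta> + 1\<close>.
\<close>

locale pagerank_potential = pagerank_query +
  fixes a :: real and \<phi> :: "real \<Rightarrow> real" and F :: "real \<Rightarrow> real \<Rightarrow> real"
  assumes a_nonneg: "a \<ge> 0" and phi_nonneg: "\<And>r. \<phi> r \<ge> 0"
    and F_nonneg: "\<And>N s. 0 \<le> N \<Longrightarrow> 0 \<le> s \<Longrightarrow> s \<le> \<Theta> + 1 \<Longrightarrow> F N s \<ge> 0"
    and F_round: "\<And>N s. 0 \<le> N \<Longrightarrow> 0 \<le> s \<Longrightarrow> s < \<Theta> \<Longrightarrow>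
      2 * a + 10 * a / \<alpha> + success t * F (N + 1) (s + 1) + (1 - success t) * F (N + 1) s \<le> F N s"
    and F_end: "\<And>N s. 1 \<le> N \<Longrightarrow> \<Theta> \<le> s \<Longrightarrow> s \<le> \<Theta> + 1 \<Longrightarrow> 7 * a + \<phi> (estimate N s) \<le> F N s"
begin

section \<open>Bounding the cost of the program by a potential\<close>

abbreviation "cost \<equiv> accumulated L pagerank_prog (ennreal a) (\<lambda>c. ennreal (\<phi> (result c)))"

lemmas exec_simps = accumulated_step length_pagerank_prog pagerank_prog_nth

lemma cost_0: "pc c < 30 \<Longrightarrow> cost 0 c = 0"
  by (simp add: halted_def length_pagerank_prog)

lemma cost_end:
  assumes c: "pc c = 23" "loop_state c N s" and N: "1 \<le> N" "\<Theta> \<le> s" "s \<le> \<Theta> + 1"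
  shows "cost k c \<le> ennreal (F N s)"
proof -
  define d where "d = real (out_degree G t)"
  define c1 where "c1 = set_real 0 (d / real (min_degree G) / real (order_of G) * s / N)
    (set_real 8 (d / real (min_degree G) / real (order_of G) * s)
    (set_real 8 (d / real (min_degree G) / real (order_of G))
    (set_real 9 (real (order_of G)) (set_real 8 (d / real (min_degree G))
    (set_real 8 d (set_nat 7 (out_degree G t) c))))))"
  have "cost k c \<le> cost (Suc (Suc (Suc (Suc (Suc (Suc (Suc k))))))) c"
    by (rule accumulated_mono) simp
  also have "\<dots> = ennreal a + (ennreal a + (ennreal a + (ennreal a + (ennreal a + (ennreal a +
      (ennreal a + cost k c1))))))"
    using c target
    by (simp add: exec_simps loop_state_def length_in_list c1_def d_def del: accumulated.simps)
  also have "cost k c1 = ennreal (\<phi> (estimate N s))"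
    using c by (simp add: accumulated_halted halted_def length_pagerank_prog c1_def d_def result_def
        estimate_def)
  also have "ennreal a + (ennreal a + (ennreal a + (ennreal a + (ennreal a + (ennreal a +
      (ennreal a + ennreal (\<phi> (estimate N s)))))))) = ennreal (7 * a + \<phi> (estimate N s))"
    using a_nonneg phi_nonneg[of "estimate N s"] by (simp add: ennreal_plus[symmetric] del: ennreal_plus)
  also have "\<dots> \<le> ennreal (F N s)"
    using F_end[OF N] by (rule ennreal_leI)
  finally show ?thesis .
qed

text \<open>
  The constants 2, 8 and 4 of the next lemmas count instructions; \<open>10 a / \<alpha>\<close> solves the
  resulting recurrence for the cost of the rest of the walk.
\<close>

definition walk_bound :: "nat \<Rightarrow> real \<Rightarrow> real \<Rightarrow> real" where
  "walk_bound v N s = 10 * a / \<alpha> + success v * F N (s + 1) + (1 - success v) * F N s"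

lemma walk_bound_nonneg:
  assumes "v \<in> pverts G" "0 \<le> N" "0 \<le> s" "s < \<Theta>"
  shows "walk_bound v N s \<ge> 0"
  unfolding walk_bound_def using assms success_pos[of v] success_le_1[of v] a_nonneg alpha_pos
  by (intro add_nonneg_nonneg mult_nonneg_nonneg F_nonneg divide_nonneg_nonneg) auto

text \<open>The loops over rounds and over walk steps lead into each other, so the bounds at their
  heads need a simultaneous induction; this predicate and \<open>walk_bounded\<close> are its two
  hypotheses.\<close>

definition head_bounded :: "nat \<Rightarrow> bool" where
  "head_bounded k \<longleftrightarrow> (\<forall>c N s. pc c = 7 \<and> loop_state c N s \<and> 0 \<le> N \<and> 0 \<le> s \<and> s < \<Theta> \<longrightarrow>
    cost k c \<le> ennreal (F N s))"

definition walk_bounded :: "nat \<Rightarrow> bool" where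
  "walk_bounded k \<longleftrightarrow> (\<forall>c N s. pc c = 9 \<and> loop_state c N s \<and> nmem c 5 \<in> pverts G \<and> 1 \<le> N \<and> 0 \<le> s \<and> s < \<Theta> \<longrightarrow>
    cost k c \<le> ennreal (walk_bound (nmem c 5) N s))"

text \<open>At the threshold the output block follows, covered by \<open>cost_end\<close>; below it
  a new round starts, covered by the induction hypothesis. The second case needs one more jump,
  hence \<open>2 * a\<close> for both.\<close>

lemma cost_test:
  assumes head: "head_bounded k"
    and c: "pc c = 21" "loop_state c N s" "1 \<le> N" "0 \<le> s" "s \<le> \<Theta> + 1"
  shows "cost (Suc (Suc k)) c \<le> ennreal (2 * a + F N s)"
proof (cases "\<Theta> \<le> s")
  case True
  have "cost (Suc (Suc k)) c = ennreal a + cost (Suc k) (branch True 23 c)"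
    using c True by (simp add: exec_simps loop_state_def del: accumulated.simps)
  also have "\<dots> \<le> ennreal a + ennreal (F N s)"
    using c True by (intro add_left_mono cost_end) (auto simp: loop_state_def)
  also have "\<dots> = ennreal (a + F N s)"
    using a_nonneg F_nonneg c by simp
  also have "\<dots> \<le> ennreal (2 * a + F N s)"
    using a_nonneg by (intro ennreal_leI) simp
  finally show ?thesis .
next
  case False
  have "cost (Suc (Suc k)) c = ennreal a + (ennreal a + cost k (branch True 7 (branch False 23 c)))"
    using c False by (simp add: exec_simps loop_state_def del: accumulated.simps)
  also have "\<dots> \<le> ennreal a + (ennreal a + ennreal (F N s))"
  proof -
    let ?c = "branch True 7 (branch False 23 c)"
    have "pc ?c = 7 \<and> loop_state ?c N s \<and> 0 \<le> N \<and> 0 \<le> s \<and> s < \<Theta>"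
      using c False by (simp add: loop_state_def)
    with head have "cost k ?c \<le> ennreal (F N s)" unfolding head_bounded_def by blast
    then show ?thesis by (intro add_left_mono)
  qed
  also have "\<dots> = ennreal (2 * a + F N s)"
    using a_nonneg F_nonneg c by (simp add: ennreal_plus[symmetric] del: ennreal_plus)
  finally show ?thesis .
qed

lemma cost_stop:
  assumes head: "head_bounded k"
    and c: "pc c = 15" "loop_state c N s" "nmem c 5 = v" "v \<in> pverts G" "1 \<le> N" "0 \<le> s" "s < \<Theta>"
  defines "q \<equiv> real (min_degree G) / real (out_degree G v)"
  shows "cost k c \<le> ennreal (8 * a + q * F N (s + 1) + (1 - q) * F N s)"
proof -
  \<comment> \<open>As \<open>q\<close> lies in the unit interval, \<open>bernoulli_pmf\<close> does
    not clip it.\<close>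
  have q: "0 \<le> q" "q \<le> 1"
    using min_degree_le[OF c(4)] degree_pos[OF c(4)] by (simp_all add: q_def)
  define c1 where "c1 = set_real 8 q (set_real 8 (real (out_degree G v)) (set_nat 7 (out_degree G v) c))"
  define c2 where "c2 b = set_real 5 (s + of_bool b) (set_real 8 (of_bool b) (set_nat 6 (of_bool b) c1))" for b
  have bound: "cost (Suc (Suc k)) (c2 b) \<le> ennreal (2 * a + F N (s + of_bool b))" for b
    using c by (intro cost_test[OF head]) (auto simp: c2_def c1_def loop_state_def)
  have nn: "F N s \<ge> 0" "F N (s + 1) \<ge> 0" using F_nonneg c by simp_all
  have "cost k c \<le> cost (Suc (Suc (Suc (Suc (Suc (Suc (Suc (Suc k)))))))) c"
    by (rule accumulated_mono) simp
  also have "\<dots> = ennreal a + (ennreal a + (ennreal a + cost (Suc (Suc (Suc (Suc (Suc k))))) c1))"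
    using c by (simp add: exec_simps loop_state_def length_in_list c1_def q_def del: accumulated.simps)
  also have "cost (Suc (Suc (Suc (Suc (Suc k))))) c1
    = ennreal a + ((ennreal a + (ennreal a + cost (Suc (Suc k)) (c2 True))) * ennreal q
        + (ennreal a + (ennreal a + cost (Suc (Suc k)) (c2 False))) * ennreal (1 - q))"
    using c q by (simp add: exec_simps loop_state_def c1_def c2_def del: accumulated.simps)
  also have "\<dots> \<le> ennreal a + ((ennreal a + (ennreal a + ennreal (2 * a + F N (s + 1)))) * ennreal q
        + (ennreal a + (ennreal a + ennreal (2 * a + F N s))) * ennreal (1 - q))"
    using bound[of True] bound[of False] by (intro add_left_mono add_mono mult_right_mono) auto
  also have "\<dots> = ennreal (a + ((a + (a + (2 * a + F N (s + 1)))) * q + (a + (a + (2 * a + F N s))) * (1 - q)))"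
    using a_nonneg nn q by (simp add: ennreal_plus[symmetric] ennreal_mult[symmetric] del: ennreal_plus)
  finally have "cost k c \<le> ennreal a + (ennreal a + (ennreal a +
    ennreal (a + ((a + (a + (2 * a + F N (s + 1)))) * q + (a + (a + (2 * a + F N s))) * (1 - q)))))"
    by (simp add: add_left_mono)
  also have "\<dots> = ennreal (a + (a + (a + (a + ((a + (a + (2 * a + F N (s + 1)))) * q + (a + (a + (2 * a + F N s))) * (1 - q))))))"
    using a_nonneg nn q by (simp add: ennreal_plus[symmetric] del: ennreal_plus)
  also have "\<dots> = ennreal (8 * a + q * F N (s + 1) + (1 - q) * F N s)"
    by (rule arg_cong[of _ _ ennreal]) (simp add: algebra_simps)
  finally show ?thesis .
qed

lemma cost_continue:
  assumes walk: "walk_bounded k"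
    and c: "pc c = 11" "loop_state c N s" "nmem c 5 = v" "v \<in> pverts G" "1 \<le> N" "0 \<le> s" "s < \<Theta>"
  shows "cost k c \<le> ennreal (4 * a + (\<Sum>u\<in>in_nbrs G v. walk_bound u N s) / real (out_degree G v))"
proof -
  let ?d = "out_degree G v"
  have d: "?d > 0" by (rule degree_pos) fact
  \<comment> \<open>The successors are indexed by the drawn position in the adjacency list; since
    the list is distinct, \<open>sum_in_list\<close> later converts positions into
    in-neighbours.\<close>
  define c1 where "c1 i = branch True 9 (set_nat 5 (in_list L v ! i) (set_nat 8 i (set_nat 7 ?d c)))" for i
  have nbr: "in_list L v ! i \<in> pverts G" if "i < ?d" for i
    using nth_mem[of i "in_list L v"] that c(4) in_nbrs_subset by (auto simp: set_in_list length_in_list)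
  have bound: "cost k (c1 i) \<le> ennreal (walk_bound (in_list L v ! i) N s)" if "i < ?d" for i
  proof -
    have "pc (c1 i) = 9 \<and> loop_state (c1 i) N s \<and> nmem (c1 i) 5 \<in> pverts G \<and> 1 \<le> N \<and> 0 \<le> s \<and> s < \<Theta>"
      using c nbr[OF that] by (simp add: c1_def loop_state_def)
    with walk have "cost k (c1 i) \<le> ennreal (walk_bound (nmem (c1 i) 5) N s)"
      unfolding walk_bounded_def by blast
    then show ?thesis by (simp add: c1_def)
  qed
  have "cost k c \<le> cost (Suc (Suc (Suc (Suc k)))) c"
    by (rule accumulated_mono) simp
  also have "\<dots> = ennreal a + (ennreal a + (\<Sum>i<?d. ennreal a + (ennreal a + cost k (c1 i))) / of_nat ?d)"
    using c d
    by (simp add: exec_simps loop_state_def length_in_list nbr_query_def c1_def nn_integral_pmf_of_set lessThan_empty_iff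
        del: accumulated.simps)
  also have "\<dots> \<le> ennreal a + (ennreal a + (\<Sum>i<?d. ennreal a + (ennreal a + ennreal (walk_bound (in_list L v ! i) N s))) / of_nat ?d)"
    using bound by (intro add_left_mono divide_right_mono_ennreal sum_mono) auto
  also have "\<dots> = ennreal (a + (a + (\<Sum>i<?d. a + (a + walk_bound (in_list L v ! i) N s)) / real ?d))"
  proof -
    have w: "walk_bound (in_list L v ! i) N s \<ge> 0" if "i < ?d" for i
      using walk_bound_nonneg[OF nbr[OF that]] c by simp
    have "(\<Sum>i<?d. ennreal a + (ennreal a + ennreal (walk_bound (in_list L v ! i) N s)))
      = (\<Sum>i<?d. ennreal (a + (a + walk_bound (in_list L v ! i) N s)))"
      using a_nonneg w by (intro sum.cong) (auto simp: ennreal_plus[symmetric] simp del: ennreal_plus)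
    also have "\<dots> = ennreal (\<Sum>i<?d. a + (a + walk_bound (in_list L v ! i) N s))"
      using a_nonneg w by (intro sum_ennreal) auto
    finally have "(\<Sum>i<?d. ennreal a + (ennreal a + ennreal (walk_bound (in_list L v ! i) N s)))
      = ennreal (\<Sum>i<?d. a + (a + walk_bound (in_list L v ! i) N s))" .
    moreover have "(\<Sum>i<?d. a + (a + walk_bound (in_list L v ! i) N s)) \<ge> 0"
      using a_nonneg w by (intro sum_nonneg) auto
    ultimately show ?thesis
      using a_nonneg d
      by (simp add: ennreal_of_nat_eq_real_of_nat divide_ennreal ennreal_plus[symmetric] del: ennreal_plus)
  qed
  also have "\<dots> = ennreal (4 * a + (\<Sum>u\<in>in_nbrs G v. walk_bound u N s) / real ?d)"
    using d by (intro arg_cong[of _ _ ennreal])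
      (simp add: sum.distrib sum_in_list[OF c(4), of "\<lambda>u. walk_bound u N s"] add_divide_distrib)
  finally show ?thesis .
qed

text \<open>The terms in \<open>F\<close> match by \<open>success_eq\<close>. For the rest, the
  share \<open>\<alpha> * A = 10 * a\<close> lost by stopping pays for the instructions, which cost
  \<open>2 * a + 8 * a * \<alpha> + 4 * a * (1 - \<alpha>) = 6 * a + 4 * a * \<alpha>\<close> on
  average.\<close>

lemma walk_bound_step:
  assumes v: "v \<in> pverts G"
  defines "q \<equiv> real (min_degree G) / real (out_degree G v)"
  shows "2 * a + (8 * a + q * F N (s + 1) + (1 - q) * F N s) * \<alpha>
    + (4 * a + (\<Sum>u\<in>in_nbrs G v. walk_bound u N s) / real (out_degree G v)) * (1 - \<alpha>)
    \<le> walk_bound v N s"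
proof -
  define A where "A = 10 * a / \<alpha>"
  define S where "S = (\<Sum>u\<in>in_nbrs G v. success u) / real (out_degree G v)"
  have A: "\<alpha> * A = 10 * a" using alpha_pos by (simp add: A_def)
  have "(\<Sum>u\<in>in_nbrs G v. walk_bound u N s)
    = (\<Sum>u\<in>in_nbrs G v. A + F N s + success u * (F N (s + 1) - F N s))"
    by (rule sum.cong) (auto simp: walk_bound_def A_def algebra_simps)
  also have "\<dots> = real (out_degree G v) * (A + F N s)
      + (\<Sum>u\<in>in_nbrs G v. success u) * (F N (s + 1) - F N s)"
    by (simp only: sum.distrib sum_constant sum_distrib_right[symmetric] card_in_nbrs[OF v] distrib_left)
  finally have W: "(\<Sum>u\<in>in_nbrs G v. walk_bound u N s) / real (out_degree G v)
    = A + F N s + S * (F N (s + 1) - F N s)"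
    using degree_pos[OF v] by (simp add: S_def add_divide_distrib)
  have s: "success v = \<alpha> * q + (1 - \<alpha>) * S"
    using success_eq[OF v] by (simp add: q_def S_def)
  have "walk_bound v N s - (2 * a + (8 * a + q * F N (s + 1) + (1 - q) * F N s) * \<alpha>
    + (A + F N s + S * (F N (s + 1) - F N s) + 4 * a) * (1 - \<alpha>)) = \<alpha> * A - 6 * a - 4 * (\<alpha> * a)"
    unfolding walk_bound_def s A_def[symmetric] by (simp add: algebra_simps)
  also have "\<dots> \<ge> 0"
    using A a_nonneg alpha_less_1 mult_right_mono[of \<alpha> 1 a] by simp
  finally show ?thesis unfolding W by (simp add: algebra_simps)
qed

text \<open>Induction on the horizon replaces a termination argument, as the bounds do not depend on
  \<open>k\<close>. In both cases the horizon is raised by one and two instructions are executed, so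
  it drops to that of the hypothesis.\<close>

lemma loop_bounded: "head_bounded k \<and> walk_bounded k"
proof (induction k)
  case 0
  show ?case by (simp add: head_bounded_def walk_bounded_def cost_0 del: accumulated.simps)
next
  case (Suc k)
  then have head: "head_bounded k" and walk: "walk_bounded k" by auto
  have "head_bounded (Suc k)"
    unfolding head_bounded_def
  proof (intro allI impI)
    fix c N s
    assume c: "pc c = 7 \<and> loop_state c N s \<and> 0 \<le> N \<and> 0 \<le> s \<and> s < \<Theta>"
    define c1 where "c1 = set_real 6 (N + 1) (set_nat 5 t c)"
    have c1: "pc c1 = 9 \<and> loop_state c1 (N + 1) s \<and> nmem c1 5 \<in> pverts G \<and> 1 \<le> N + 1 \<and> 0 \<le> s \<and> s < \<Theta>"
      using c target by (simp add: c1_def loop_state_def)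
    have "cost (Suc k) c \<le> cost (Suc (Suc k)) c" by (rule accumulated_Suc)
    also have "\<dots> = ennreal a + (ennreal a + cost k c1)"
      using c by (simp add: exec_simps loop_state_def c1_def del: accumulated.simps)
    also have "\<dots> \<le> ennreal a + (ennreal a + ennreal (walk_bound (nmem c1 5) (N + 1) s))"
      using walk c1 unfolding walk_bounded_def by (intro add_left_mono) blast
    also have "\<dots> = ennreal (a + (a + walk_bound t (N + 1) s))"
      using a_nonneg walk_bound_nonneg[OF target, of "N + 1" s] c
      by (simp add: c1_def ennreal_plus[symmetric] del: ennreal_plus)
    also have "\<dots> \<le> ennreal (F N s)"
      using F_round[of N s] c by (intro ennreal_leI) (simp add: walk_bound_def)
    finally show "cost (Suc k) c \<le> ennreal (F N s)" .
  qed
  moreover have "walk_bounded (Suc k)"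
    unfolding walk_bounded_def
  proof (intro allI impI)
    fix c N s
    assume c: "pc c = 9 \<and> loop_state c N s \<and> nmem c 5 \<in> pverts G \<and> 1 \<le> N \<and> 0 \<le> s \<and> s < \<Theta>"
    define v where "v = nmem c 5"
    define q where "q = real (min_degree G) / real (out_degree G v)"
    define c1 where "c1 = branch True 15 (set_nat 6 1 c)"
    define c0 where "c0 = branch False 15 (set_nat 6 0 c)"
    define x1 where "x1 = 8 * a + q * F N (s + 1) + (1 - q) * F N s"
    define x0 where "x0 = 4 * a + (\<Sum>u\<in>in_nbrs G v. walk_bound u N s) / real (out_degree G v)"
    have v: "v \<in> pverts G" using c by (simp add: v_def)
    have b1: "cost k c1 \<le> ennreal x1"
      unfolding x1_def q_def using c
      by (intro cost_stop[OF head]) (auto simp: c1_def loop_state_def v_def)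
    have b0: "cost k c0 \<le> ennreal x0"
      unfolding x0_def using c
      by (intro cost_continue[OF walk]) (auto simp: c0_def loop_state_def v_def)
    have q: "0 \<le> q" "q \<le> 1"
      using min_degree_le[OF v] degree_pos[OF v] by (simp_all add: q_def)
    have nn: "x1 \<ge> 0" "x0 \<ge> 0"
      unfolding x1_def x0_def using a_nonneg q c in_nbrs_subset
      by (auto intro!: add_nonneg_nonneg mult_nonneg_nonneg F_nonneg divide_nonneg_nonneg sum_nonneg
          walk_bound_nonneg)
    have "cost (Suc k) c \<le> cost (Suc (Suc k)) c" by (rule accumulated_Suc)
    also have "\<dots> = ennreal a + ((ennreal a + cost k c1) * ennreal \<alpha> + (ennreal a + cost k c0) * ennreal (1 - \<alpha>))"
      using c alpha_pos alpha_less_1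
      by (simp add: exec_simps loop_state_def c1_def c0_def del: accumulated.simps)
    also have "\<dots> \<le> ennreal a + ((ennreal a + ennreal x1) * ennreal \<alpha> + (ennreal a + ennreal x0) * ennreal (1 - \<alpha>))"
      using b1 b0 by (intro add_left_mono add_mono mult_right_mono) auto
    also have "\<dots> = ennreal (a + ((a + x1) * \<alpha> + (a + x0) * (1 - \<alpha>)))"
      using a_nonneg nn alpha_pos alpha_less_1
      by (simp add: ennreal_plus[symmetric] ennreal_mult[symmetric] del: ennreal_plus)
    also have "\<dots> \<le> ennreal (walk_bound v N s)"
      using walk_bound_step[OF v, of N s]
      by (intro ennreal_leI) (simp add: x1_def x0_def q_def algebra_simps)
    finally show "cost (Suc k) c \<le> ennreal (walk_bound (nmem c 5) N s)" by (simp add: v_def)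
  qed
  ultimately show ?case by simp
qed

text \<open>Seven instructions set up the constants; the counters need none, since unassigned cells
  hold 0.\<close>

lemma cost_init:
  "cost k (init_config (order_of G) t (min_degree G) \<alpha> \<epsilon>) \<le> ennreal (7 * a + F 0 0)"
proof -
  let ?c = "init_config (order_of G) t (min_degree G) \<alpha> \<epsilon>"
  define c1 where "c1 = set_real 7 (real (min_degree G)) (set_real 3 \<Theta> (set_real 4 (\<epsilon> * \<epsilon>)
    (set_real 3 24 (set_nat 4 24 (set_real 2 1 (set_nat 3 1 ?c))))))"
  have "cost k ?c \<le> cost (Suc (Suc (Suc (Suc (Suc (Suc (Suc k))))))) ?c"
    by (rule accumulated_mono) simp
  also have "\<dots> = ennreal a + (ennreal a + (ennreal a + (ennreal a + (ennreal a + (ennreal a +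
      (ennreal a + cost k c1))))))"
    by (simp add: exec_simps init_config_def c1_def \<Theta>_def power2_eq_square numeral_2_eq_2[symmetric]
        del: accumulated.simps)
  also have "\<dots> \<le> ennreal a + (ennreal a + (ennreal a + (ennreal a + (ennreal a + (ennreal a +
      (ennreal a + ennreal (F 0 0)))))))"
  proof -
    have "pc c1 = 7 \<and> loop_state c1 0 0 \<and> 0 \<le> (0::real) \<and> 0 \<le> (0::real) \<and> 0 < \<Theta>"
      using Theta_ge by (simp add: c1_def init_config_def loop_state_def)
    then have "cost k c1 \<le> ennreal (F 0 0)"
      using loop_bounded[of k] unfolding head_bounded_def by blast
    then show ?thesis by (intro add_left_mono)
  qed
  also have "\<dots> = ennreal (7 * a + F 0 0)"
    using a_nonneg F_nonneg[of 0 0] Theta_ge by (simp add: ennreal_plus[symmetric] del: ennreal_plus)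
  finally show ?thesis .
qed

end

section \<open>Potentials for running time and accuracy\<close>

context pagerank_query
begin

text \<open>The potential charges \<open>w\<close> for each success still to come and 7 for the
  output block. In units of the time bound, \<open>(\<Theta> + 1) * w\<close> is at most
  \<open>25 * 12 = 300\<close>, and the two blocks of 7 instructions add at most 14.\<close>

lemma expected_time_pagerank_prog:
  "expected_time L pagerank_prog (init_config (order_of G) t (min_degree G) \<alpha> \<epsilon>)
    \<le> ennreal (314 * pagerank_time_bound G \<alpha> t \<epsilon>)"
proof -
  define p where "p = success t"
  have p: "0 < p" "p \<le> 1" using success_pos[OF target] success_le_1[OF target] by (simp_all add: p_def)
  note a = alpha_pos alpha_less_1 and e = eps_pos eps_le_1
  \<comment> \<open>A round costs at most \<open>2 + 10 / \<alpha> \<le> 12 / \<alpha>\<close> on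
    average and succeeds with probability \<open>p\<close>, so this is the price of one
    success.\<close>
  define w where "w = 12 / (\<alpha> * p)"
  have w: "w > 0" "p * w = 12 / \<alpha>" using p a by (simp_all add: w_def)
  interpret pagerank_potential G \<alpha> L \<epsilon> t 1 "\<lambda>_. 0" "\<lambda>N s. (\<Theta> + 1 - s) * w + 7"
  proof
    fix N s :: real
    show "0 \<le> (\<Theta> + 1 - s) * w + 7" if "s \<le> \<Theta> + 1" using w that by simp
    show "7 * 1 + 0 \<le> (\<Theta> + 1 - s) * w + 7" if "s \<le> \<Theta> + 1" using w that by simp
    have "2 * 1 + 10 * 1 / \<alpha> + p * ((\<Theta> + 1 - (s + 1)) * w + 7) + (1 - p) * ((\<Theta> + 1 - s) * w + 7)
      = 2 + 10 / \<alpha> - p * w + ((\<Theta> + 1 - s) * w + 7)" by (simp add: algebra_simps)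
    also have "2 + 10 / \<alpha> - p * w \<le> 0" unfolding w using a by (simp add: field_simps)
    finally show "2 * 1 + 10 * 1 / \<alpha> + success t * ((\<Theta> + 1 - (s + 1)) * w + 7)
      + (1 - success t) * ((\<Theta> + 1 - s) * w + 7) \<le> (\<Theta> + 1 - s) * w + 7" by (simp add: p_def)
  qed auto
  have "expected_time L pagerank_prog (init_config (order_of G) t (min_degree G) \<alpha> \<epsilon>)
    \<le> ennreal (7 * 1 + ((\<Theta> + 1 - 0) * w + 7))"
    by (rule expected_time_le) (use cost_init in simp)
  also have "\<dots> \<le> ennreal (314 * pagerank_time_bound G \<alpha> t \<epsilon>)"
  proof (rule ennreal_leI)
    have e2: "0 < \<epsilon>\<^sup>2" "\<epsilon>\<^sup>2 \<le> 1" using e by (auto simp: power_le_one)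
    have B: "pagerank_time_bound G \<alpha> t \<epsilon> = 1 / (\<alpha> * \<epsilon>\<^sup>2 * p)"
      using pagerank_time_bound_eq[OF target] by (simp add: p_def success_def)
    have "\<alpha> * (\<epsilon>\<^sup>2 * p) \<le> 1"
      using a e2 p by (intro mult_le_one) auto
    then have B1: "1 \<le> pagerank_time_bound G \<alpha> t \<epsilon>" unfolding B using a e2 p by (simp add: mult_ac)
    have "1 \<le> 1 / \<epsilon>\<^sup>2" using e2 by simp
    then have "\<Theta> + 1 \<le> 25 / \<epsilon>\<^sup>2" by (simp add: \<Theta>_def)
    then have "(\<Theta> + 1) * w \<le> 25 / \<epsilon>\<^sup>2 * w" using w by (intro mult_right_mono) auto
    also have "\<dots> = 300 * pagerank_time_bound G \<alpha> t \<epsilon>" by (simp add: B w_def mult_ac)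
    finally show "7 * 1 + ((\<Theta> + 1 - 0) * w + 7) \<le> 314 * pagerank_time_bound G \<alpha> t \<epsilon>" using B1 by simp
  qed
  finally show ?thesis .
qed

text \<open>The estimate is \<open>x * (s / (p * N))\<close>. Passing to this reciprocal doubles the
  tolerance \<open>\<epsilon> / 2\<close> at most, because
  \<open>(1 + \<epsilon>) * (1 - \<epsilon> / 2) \<ge> 1\<close> for
  \<open>\<epsilon> \<le> 1\<close> and
  \<open>(1 - \<epsilon>) * (1 + \<epsilon> / 2) \<le> 1\<close>.\<close>

lemma estimate_accurate:
  assumes "0 < N" "0 < s" and close: "\<bar>success t * N - s\<bar> \<le> \<epsilon> / 2 * s"
  defines "x \<equiv> vec_index (pagerank G \<alpha>) t"
  shows "\<bar>estimate N s - x\<bar> \<le> \<epsilon> * x"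
proof -
  define p where "p = success t"
  note e = eps_pos eps_le_1
  have p: "0 < p" using success_pos[OF target] by (simp add: p_def)
  have d: "real (out_degree G t) > 0" "real (min_degree G) > 0"
    using degree_pos[OF target] min_degree_pos by simp_all
  have n: "real (order_of G) > 0" using target verts_iff[of t] by simp
  have px: "p = real (min_degree G) * real (order_of G) * x / real (out_degree G t)"
    by (simp add: p_def success_def pagerank_density_def x_def)
  have x: "x > 0"
  proof (rule ccontr)
    assume "\<not> x > 0"
    then have "p \<le> 0" unfolding px using d n by (intro divide_nonpos_pos mult_nonneg_nonpos) auto
    with p show False by simp
  qed
  have est: "estimate N s = x * (s / (p * N))"
    using x d n unfolding px estimate_def by (simp add: mult_ac)
  have close': "\<bar>p * N - s\<bar> \<le> \<epsilon> / 2 * s" using close by (simp add: p_def)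
  have bounds: "(1 - \<epsilon> / 2) * s \<le> p * N" "p * N \<le> (1 + \<epsilon> / 2) * s"
    using close' unfolding left_diff_distrib distrib_right mult_1 abs_le_iff by linarith+
  have pN: "p * N > 0" using p \<open>0 < N\<close> by simp
  have "s \<le> (1 + \<epsilon>) * (p * N)"
  proof -
    have "s \<le> (1 + \<epsilon>) * ((1 - \<epsilon> / 2) * s)"
    proof -
      have "\<epsilon> * \<epsilon> \<le> \<epsilon>" using e by (simp add: mult_left_le)
      then have "1 \<le> (1 + \<epsilon>) * (1 - \<epsilon> / 2)" by (simp add: algebra_simps)
      then have "1 * s \<le> (1 + \<epsilon>) * (1 - \<epsilon> / 2) * s" using \<open>0 < s\<close> by (intro mult_right_mono) auto
      then show ?thesis by (simp add: mult.assoc)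
    qed
    also have "\<dots> \<le> (1 + \<epsilon>) * (p * N)"
      using bounds e by (intro mult_left_mono) auto
    finally show ?thesis .
  qed
  then have up: "s / (p * N) \<le> 1 + \<epsilon>" using pN by (simp add: divide_le_eq)
  have "(1 - \<epsilon>) * (p * N) \<le> (1 - \<epsilon>) * ((1 + \<epsilon> / 2) * s)"
    using bounds e by (intro mult_left_mono) auto
  also have "\<dots> \<le> s"
  proof -
    have "(1 - \<epsilon>) * (1 + \<epsilon> / 2) \<le> 1" using e by (simp add: algebra_simps)
    then have "(1 - \<epsilon>) * (1 + \<epsilon> / 2) * s \<le> 1 * s" using \<open>0 < s\<close> by (intro mult_right_mono) auto
    then show ?thesis by (simp add: mult.assoc)
  qed
  finally have lo: "1 - \<epsilon> \<le> s / (p * N)" using pN by (simp add: le_divide_eq)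
  have "estimate N s - x = x * (s / (p * N) - 1)" unfolding est by (simp add: algebra_simps)
  then have "\<bar>estimate N s - x\<bar> = x * \<bar>s / (p * N) - 1\<bar>" using x by (simp add: abs_mult)
  also have "\<dots> \<le> x * \<epsilon>" using up lo x by (intro mult_left_mono) auto
  finally show ?thesis by (simp add: mult.commute)
qed

text \<open>With steps free of charge and a bad output costing 1, the cost is the failure
  probability. In a round the squared deviation grows by \<open>p * (1 - p)\<close> on average and
  the second term of \<open>F\<close> shrinks by the same amount, so \<open>F_round\<close> holds
  with equality.\<close>

lemma failure_pagerank_prog:
  defines "x \<equiv> vec_index (pagerank G \<alpha>) t"
  shows "accumulated L pagerank_prog 0 (indicator {c. \<bar>result c - x\<bar> > \<epsilon> * x}) k
      (init_config (order_of G) t (min_degree G) \<alpha> \<epsilon>) \<le> ennreal (3 / 16)"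
proof -
  define p where "p = success t"
  have p: "0 < p" "p \<le> 1" using success_pos[OF target] success_le_1[OF target] by (simp_all add: p_def)
  note e = eps_pos eps_le_1
  \<comment> \<open>A bad output at \<open>s \<ge> \<Theta>\<close> forces a deviation of at least
    \<open>\<epsilon> / 2 * \<Theta>\<close>; dividing by its square makes \<open>F\<close> at least
    1 there, as in Chebyshev's inequality.\<close>
  define K where "K = (\<epsilon> / 2 * \<Theta>)\<^sup>2"
  have K: "K > 0" using e Theta_ge by (simp add: K_def)
  define F where "F N s = ((p * N - s)\<^sup>2 + (1 - p) * (\<Theta> + 1 - s)) / K" for N s
  define \<phi> :: "real \<Rightarrow> real" where "\<phi> r = of_bool (\<bar>r - x\<bar> > \<epsilon> * x)" for r
  interpret pagerank_potential G \<alpha> L \<epsilon> t 0 \<phi> F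
  proof
    fix N s :: real
    show "\<phi> r \<ge> 0" for r by (simp add: \<phi>_def)
    show "0 \<le> F N s" if "s \<le> \<Theta> + 1" using K p that by (simp add: F_def)
    have "p * ((p * (N + 1) - (s + 1))\<^sup>2 + (1 - p) * (\<Theta> + 1 - (s + 1)))
        + (1 - p) * ((p * (N + 1) - s)\<^sup>2 + (1 - p) * (\<Theta> + 1 - s))
      = (p * N - s)\<^sup>2 + (1 - p) * (\<Theta> + 1 - s)" by (simp add: power2_eq_square algebra_simps)
    then have "p * F (N + 1) (s + 1) + (1 - p) * F (N + 1) s = F N s"
      by (simp add: F_def add_divide_distrib[symmetric])
    then show "2 * 0 + 10 * 0 / \<alpha> + success t * F (N + 1) (s + 1) + (1 - success t) * F (N + 1) s \<le> F N s"
      by (simp add: p_def)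
    show "7 * 0 + \<phi> (estimate N s) \<le> F N s" if N: "1 \<le> N" "\<Theta> \<le> s" "s \<le> \<Theta> + 1"
    proof (cases "\<bar>p * N - s\<bar> \<le> \<epsilon> / 2 * s")
      case True
      then have "\<phi> (estimate N s) = 0"
        using estimate_accurate[of N s] N Theta_ge by (simp add: \<phi>_def p_def x_def)
      then show ?thesis using K p N by (simp add: F_def)
    next
      case False
      have "\<epsilon> / 2 * \<Theta> \<le> \<epsilon> / 2 * s" using N e by simp
      with False have "\<epsilon> / 2 * \<Theta> \<le> \<bar>p * N - s\<bar>" by linarith
      then have "K \<le> \<bar>p * N - s\<bar>\<^sup>2" unfolding K_def using e Theta_ge by (intro power_mono) auto
      moreover have "(1 - p) * (\<Theta> + 1 - s) \<ge> 0" using p N by simp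
      ultimately have "1 \<le> F N s" using K by (simp add: F_def)
      moreover have "\<phi> (estimate N s) \<le> 1" by (simp add: \<phi>_def)
      ultimately show ?thesis by linarith
    qed
  qed auto
  have "F 0 0 \<le> 3 / 16"
  proof -
    have "K = 6 * \<Theta>" using e by (simp add: K_def \<Theta>_def power2_eq_square)
    then have "F 0 0 = (1 - p) * (\<Theta> + 1) / (6 * \<Theta>)" by (simp add: F_def)
    also have "\<dots> \<le> 1 * (\<Theta> + 1) / (6 * \<Theta>)"
      using p Theta_ge by (intro divide_right_mono mult_right_mono) auto
    also have "\<dots> \<le> 3 / 16" using Theta_ge by (simp add: field_simps)
    finally show ?thesis .
  qed
  then have "ennreal (7 * 0 + F 0 0) \<le> ennreal (3 / 16)" by (intro ennreal_leI) simp
  moreover have "(\<lambda>c. ennreal (\<phi> (result c))) = indicator {c. \<bar>result c - x\<bar> > \<epsilon> * x}"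
    by (auto simp: \<phi>_def indicator_def)
  ultimately show ?thesis using cost_init[of k] by (simp add: order_trans)
qed

end

text \<open>A single program and constant serve all inputs. The time bounds are compared for
  \<open>\<alpha>\<close> bounded away from 1: at the centre of a star with arcs in both directions
  their ratio is unbounded as \<open>\<alpha>\<close> tends to 1 and the star grows.\<close>

theorem theorem1p9:
  shows "(\<exists>(P :: instr list) (C :: real). C > 0 \<and>
      (\<forall>(G :: nat pair_pre_digraph) L (\<alpha> :: real) (\<epsilon> :: real) t.
        labelled_digraph G \<and> eulerian G \<and> min_degree G > 0 \<and> represents L G \<and>
        0 < \<alpha> \<and> \<alpha> < 1 \<and> 0 < \<epsilon> \<and> \<epsilon> \<le> 1 \<and> t \<in> pverts G \<longrightarrow>
        (let c = init_config (order_of G) t (min_degree G) \<alpha> \<epsilon>;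
             T = C * pagerank_time_bound G \<alpha> t \<epsilon>
         in succeeds_within L P c (vec_index (pagerank G \<alpha>) t) \<epsilon> T (3 / 4) \<and>
            expected_time L P c \<le> ennreal T)))
    \<and> (\<forall>\<alpha>\<^sub>0 < (1 :: real). \<exists>C > (0 :: real).
        \<forall>(G :: nat pair_pre_digraph) (\<alpha> :: real) (\<epsilon> :: real) t.
          labelled_digraph G \<and> eulerian G \<and> min_degree G > 0 \<and>
          0 < \<alpha> \<and> \<alpha> \<le> \<alpha>\<^sub>0 \<and> 0 < \<epsilon> \<and> \<epsilon> \<le> 1 \<and> t \<in> pverts G \<longrightarrow>
          pagerank_time_bound G \<alpha> t \<epsilon> \<le> C * degree_time_bound G \<alpha> t \<epsilon>)"
    (is "?algorithm \<and> ?bounds")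
proof
  \<comment> \<open>The constant 5024 is \<open>16 * 314\<close>: \<open>succeeds_withinI\<close>
    asks for a time budget of sixteen times the expected time.\<close>
  have "succeeds_within L pagerank_prog c (vec_index (pagerank G \<alpha>) t) \<epsilon> T (3 / 4) \<and>
      expected_time L pagerank_prog c \<le> ennreal T"
    if "labelled_digraph G" "eulerian G" "min_degree G > 0" "represents L G"
      "0 < \<alpha>" "\<alpha> < 1" "0 < \<epsilon>" "\<epsilon> \<le> 1" "t \<in> pverts G"
      and c: "c = init_config (order_of G) t (min_degree G) \<alpha> \<epsilon>"
      and T: "T = 5024 * pagerank_time_bound G \<alpha> t \<epsilon>"
    for G :: "nat pair_pre_digraph" and L and \<alpha> \<epsilon> T :: real and t c
  proof -
    interpret pagerank_query G \<alpha> L \<epsilon> t by unfold_locales (use that in auto)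
    have T0: "T \<ge> 0"
      unfolding T pagerank_time_bound_eq[OF target]
      using density_pos[OF target] min_degree_pos alpha_pos by simp
    have time: "expected_time L pagerank_prog c \<le> ennreal (T / 16)"
      using expected_time_pagerank_prog by (simp add: c T)
    also have "\<dots> \<le> ennreal T" using T0 by (intro ennreal_leI) simp
    finally have "expected_time L pagerank_prog c \<le> ennreal T" .
    moreover have "succeeds_within L pagerank_prog c (vec_index (pagerank G \<alpha>) t) \<epsilon> T (3 / 4)"
      using time T0 failure_pagerank_prog unfolding c by (rule succeeds_withinI)
    ultimately show ?thesis by simp
  qed
  then show ?algorithm
    unfolding Let_def by (intro exI[of _ pagerank_prog] exI[of _ 5024] conjI[of "5024 > 0"]) auto
  show ?bounds
  proof (intro allI impI)
    fix \<alpha>\<^sub>0 :: real assume "\<alpha>\<^sub>0 < 1"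
    show "\<exists>C > (0 :: real). \<forall>(G :: nat pair_pre_digraph) (\<alpha> :: real) (\<epsilon> :: real) t.
          labelled_digraph G \<and> eulerian G \<and> min_degree G > 0 \<and>
          0 < \<alpha> \<and> \<alpha> \<le> \<alpha>\<^sub>0 \<and> 0 < \<epsilon> \<and> \<epsilon> \<le> 1 \<and> t \<in> pverts G \<longrightarrow>
          pagerank_time_bound G \<alpha> t \<epsilon> \<le> C * degree_time_bound G \<alpha> t \<epsilon>"
    proof (intro exI[of _ "6 / (1 - \<alpha>\<^sub>0)"] conjI allI impI; (elim conjE)?)
      show "6 / (1 - \<alpha>\<^sub>0) > 0" using \<open>\<alpha>\<^sub>0 < 1\<close> by simp
      fix G :: "nat pair_pre_digraph" and \<alpha> \<epsilon> :: real and t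
      assume *: "labelled_digraph G" "eulerian G" "min_degree G > 0" "0 < \<alpha>" "\<alpha> \<le> \<alpha>\<^sub>0" "t \<in> pverts G"
      interpret eulerian_pagerank G \<alpha> by unfold_locales (use * \<open>\<alpha>\<^sub>0 < 1\<close> in auto)
      have "degree_time_bound G \<alpha> t \<epsilon> \<ge> 0"
        using alpha_pos by (simp add: degree_time_bound_def Let_def)
      then have "6 / (1 - \<alpha>) * degree_time_bound G \<alpha> t \<epsilon> \<le> 6 / (1 - \<alpha>\<^sub>0) * degree_time_bound G \<alpha> t \<epsilon>"
        using * \<open>\<alpha>\<^sub>0 < 1\<close> by (intro mult_right_mono frac_le) auto
      with pagerank_time_bound_le[OF \<open>t \<in> pverts G\<close>, of \<epsilon>]
      show "pagerank_time_bound G \<alpha> t \<epsilon> \<le> 6 / (1 - \<alpha>\<^sub>0) * degree_time_bound G \<alpha> t \<epsilon>" by simp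
    qed
  qed
qed

end
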